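(* Let $(X,\|\cdot\|,\tau)$ be a sequentially complete d-consistent Mazur--Saks space and $(T(t))_{t\geq 0}$ a bi-continuous semigroup on $X$. Set \[ \|x\|^{\bullet}=\sup_{x^{\bullet}\in X^{\bullet},\ \|x^{\bullet}\|_{X'}\leq 1}|\langle x^{\bullet},x\rangle|,\quad x\in X. \] Then $\|\cdot\|^{\bullet}$ and $\|\cdot\|$ are equivalent norms on $X$.
   Context: Vector spaces are over $\mathbb{K}=\mathbb{R}$ or $\mathbb{C}$. For a Banach space $(X,\|\cdot\|)$, $X'$ is the norm dual with dual norm $\|\cdot\|_{X'}$ and $\mathcal{L}(X)$ the bounded operators on $X$. Let $(X,\|\cdot\|)$ be a Banach space and $\tau$ a Hausdorff locally convex topology on $X$ coarser than the norm topology $\tau_{\|\cdot\|}$. The mixed topology $\gamma=\gamma(\|\cdot\|,\tau)$ is the finest linear topology on $X$ that coincides with $\tau$ on $\|\cdot\|$-bounded sets and satisfies $\tau\le\gamma\le\tau_{\|\cdot\|}$ (it is Hausdorff locally convex). $(X,\|\cdot\|,\tau)$ is a Saks space if there is a directed system of seminorms $\mathcal{P}_\tau$ generating $\tau$ with $\|x\|=\sup_{p\in\mathcal{P}_\tau}p(x)$ for all $x\in X$; it is sequentially complete if $(X,\gamma)$ is sequentially complete; it is Mazur (a Mazur--Saks space) if every linear $\gamma$-sequentially continuous functional on $X$ is $\gamma$-continuous. $X^{\circ}=\{x'\in X' : x' \text{ is } \tau\text{-sequentially continuous on } \|\cdot\|\text{-bounded sets}\}$, a closed subspace of $X'$. $(X,\|\cdot\|,\tau)$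 is d-consistent if (i) $X^{\circ}\cap\{x'\in X':\|x'\|_{X'}\le1\}$ is sequentially complete w.r.t. $\sigma(X^{\circ},X)$, and (ii) every $\|\cdot\|_{X'}$-bounded $\sigma(X^{\circ},X)$-null sequence in $X^{\circ}$ is $\tau$-equicontinuous on $\|\cdot\|$-bounded sets (i.e. its restriction to every $\|\cdot\|$-bounded set $B$ is equicontinuous for the topology induced by $\tau$ on $B$). A bi-continuous semigroup on $X$ is a family $(T(t))_{t\ge0}$ in $\mathcal{L}(X)$ with $T(0)=\mathrm{id}$, $T(t+s)=T(t)T(s)$; $t\mapsto T(t)x\in(X,\gamma)$ continuous on $[0,\infty)$ for every $x\in X$; and, whenever $x_n\to x$ in $(X,\gamma)$, $T(t)(x_n-x)\to0$ in $(X,\gamma)$ locally uniformly in $t\in[0,\infty)$. The dual operators $T(t)'$ leave $X^\circ$ invariant; $T^{\circ}(t)=T(t)'|_{X^{\circ}}$. The bi-sun dual is $X^{\bullet}=\{x^{\circ}\in X^{\circ} : \lim_{t\to0+}\|T^{\circ}(t)x^{\circ}-x^{\circ}\|_{X'}=0\}$. *)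

theory Defs
  imports "HOL-Analysis.Analysis"
begin

section \<open>Scalars and Banach spaces over them\<close>

text \<open>The scalar field is a type \<open>'k\<close> that is isometrically isomorphic, as a normed field, to
  the reals or to the complex numbers.\<close>

definition normed_field_iso :: "('k::real_normed_field \<Rightarrow> 'l::real_normed_field) \<Rightarrow> bool" where
  "normed_field_iso \<phi> \<longleftrightarrow> bij \<phi> \<and> (\<forall>a b. \<phi> (a + b) = \<phi> a + \<phi> b) \<and>
     (\<forall>a b. \<phi> (a * b) = \<phi> a * \<phi> b) \<and> (\<forall>a. norm (\<phi> a) = norm a)"

definition real_or_complex :: "'k::real_normed_field itself \<Rightarrow> bool" where
  "real_or_complex _ \<longleftrightarrow>
     (\<exists>\<phi> :: 'k \<Rightarrow> real. normed_field_iso \<phi>) \<or> (\<exists>\<phi> :: 'k \<Rightarrow> complex. normed_field_iso \<phi>)"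

lemma real_or_complex_real: "real_or_complex TYPE(real)"
  unfolding real_or_complex_def normed_field_iso_def by (rule disjI1, rule exI[of _ id]) simp

lemma real_or_complex_complex: "real_or_complex TYPE(complex)"
  unfolding real_or_complex_def normed_field_iso_def by (rule disjI2, rule exI[of _ id]) simp

text \<open>The carrier is a type of class \<^class>\<open>banach\<close>, which provides the norm and its completeness; the
  class only knows multiplication by reals, so the action of \<open>'k\<close> is an explicit parameter
  extending it.\<close>

locale banach_space_over = vector_space scaleK
  for scaleK :: "'k::real_normed_field \<Rightarrow> 'a::banach \<Rightarrow> 'a" +
  assumes norm_scale: "norm (scaleK c x) = norm c * norm x"
    and scale_of_real: "scaleK (of_real r) x = r *\<^sub>R x"

section \<open>Linear topologies\<close>

definition topology_coarser :: "'a topology \<Rightarrow> 'a topology \<Rightarrow> bool" where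
  "topology_coarser \<sigma> \<tau> \<longleftrightarrow> (\<forall>U. openin \<sigma> U \<longrightarrow> openin \<tau> U)"

definition linear_topology ::
  "('k::real_normed_field \<Rightarrow> 'a::banach \<Rightarrow> 'a) \<Rightarrow> 'a topology \<Rightarrow> bool" where
  "linear_topology scaleK \<tau> \<longleftrightarrow> topspace \<tau> = UNIV \<and>
     continuous_map (prod_topology \<tau> \<tau>) \<tau> (\<lambda>(x, y). x + y) \<and>
     continuous_map (prod_topology euclidean \<tau>) \<tau> (\<lambda>(c, x). scaleK c x)"

definition locally_convex_topology ::
  "('k::real_normed_field \<Rightarrow> 'a::banach \<Rightarrow> 'a) \<Rightarrow> 'a topology \<Rightarrow> bool" where
  "locally_convex_topology scaleK \<tau> \<longleftrightarrow> linear_topology scaleK \<tau> \<and>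
     (\<forall>U. openin \<tau> U \<and> 0 \<in> U \<longrightarrow> (\<exists>V. openin \<tau> V \<and> convex V \<and> 0 \<in> V \<and> V \<subseteq> U))"

definition top_Cauchy :: "'v::ab_group_add topology \<Rightarrow> (nat \<Rightarrow> 'v) \<Rightarrow> bool" where
  "top_Cauchy \<tau> s \<longleftrightarrow>
     (\<forall>U. openin \<tau> U \<and> 0 \<in> U \<longrightarrow> (\<exists>N. \<forall>m\<ge>N. \<forall>n\<ge>N. s m - s n \<in> U))"

definition sequentially_complete_in :: "'v::ab_group_add topology \<Rightarrow> 'v set \<Rightarrow> bool" where
  "sequentially_complete_in \<tau> S \<longleftrightarrow>
     (\<forall>s. range s \<subseteq> S \<and> top_Cauchy \<tau> s \<longrightarrow> (\<exists>l\<in>S. limitin \<tau> s l sequentially))"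

section \<open>The mixed topology\<close>

definition mixed_candidate ::
  "('k::real_normed_field \<Rightarrow> 'a::banach \<Rightarrow> 'a) \<Rightarrow> 'a topology \<Rightarrow> 'a topology \<Rightarrow> bool" where
  "mixed_candidate scaleK \<tau> \<gamma> \<longleftrightarrow> linear_topology scaleK \<gamma> \<and>
     (\<forall>B. bounded B \<longrightarrow> subtopology \<gamma> B = subtopology \<tau> B) \<and>
     topology_coarser \<tau> \<gamma> \<and> topology_coarser \<gamma> euclidean"

definition mixed_topology ::
  "('k::real_normed_field \<Rightarrow> 'a::banach \<Rightarrow> 'a) \<Rightarrow> 'a topology \<Rightarrow> 'a topology" where
  "mixed_topology scaleK \<tau> = (THE \<gamma>. mixed_candidate scaleK \<tau> \<gamma> \<and>
     (\<forall>\<sigma>. mixed_candidate scaleK \<tau> \<sigma> \<longrightarrow> topology_coarser \<sigma> \<gamma>))"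

text \<open>The definite description is proper: the supremum of all candidates is again a candidate.\<close>

lemma ex1_mixed_topology:
  fixes scaleK :: "'k::real_normed_field \<Rightarrow> 'a::banach \<Rightarrow> 'a"
  assumes lin: "linear_topology scaleK \<tau>" and le: "topology_coarser \<tau> euclidean"
  shows "\<exists>!\<gamma>. mixed_candidate scaleK \<tau> \<gamma> \<and>
           (\<forall>\<sigma>. mixed_candidate scaleK \<tau> \<sigma> \<longrightarrow> topology_coarser \<sigma> \<gamma>)"
proof -
  define \<S> where "\<S> = (\<Union>\<sigma>\<in>Collect (mixed_candidate scaleK \<tau>). Collect (openin \<sigma>))"
  define \<gamma> where "\<gamma> = topology_generated_by \<S>"
  have \<tau>: "mixed_candidate scaleK \<tau> \<tau>"
    using lin le by (auto simp: mixed_candidate_def topology_coarser_def)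
  have UNIV\<S>: "\<Union>\<S> = UNIV"
  proof -
    have "UNIV \<in> \<S>"
      unfolding \<S>_def using \<tau> lin openin_topspace[of \<tau>]
      by (auto simp: linear_topology_def intro!: exI[of _ \<tau>])
    then show ?thesis by blast
  qed
  have top\<gamma>: "topspace \<gamma> = UNIV"
    by (simp add: \<gamma>_def UNIV\<S>)
  have finer: "topology_coarser \<sigma> \<gamma>" if "mixed_candidate scaleK \<tau> \<sigma>" for \<sigma>
    using that unfolding topology_coarser_def \<gamma>_def \<S>_def
    by (auto intro!: topology_generated_by_Basis)
  have into: "continuous_map T \<gamma> f"
    if f: "\<And>\<sigma>. mixed_candidate scaleK \<tau> \<sigma> \<Longrightarrow> continuous_map T \<sigma> f"
    for T :: "'c topology" and f
    unfolding \<gamma>_def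
  proof (rule continuous_on_generated_topo)
    show "openin T (f -` U \<inter> topspace T)" if U: "U \<in> \<S>" for U
    proof -
      obtain \<sigma> where \<sigma>: "mixed_candidate scaleK \<tau> \<sigma>" "openin \<sigma> U"
        using U by (auto simp: \<S>_def)
      have "openin T {x \<in> topspace T. f x \<in> U}"
        using f[OF \<sigma>(1)] \<sigma>(2) by (rule openin_continuous_map_preimage)
      moreover have "{x \<in> topspace T. f x \<in> U} = f -` U \<inter> topspace T" by auto
      ultimately show ?thesis by simp
    qed
    show "f ` topspace T \<subseteq> \<Union> \<S>" by (simp add: UNIV\<S>)
  qed
  have id\<sigma>: "continuous_map \<gamma> \<sigma> (\<lambda>x. x)" if \<sigma>: "mixed_candidate scaleK \<tau> \<sigma>" for \<sigma>
    using finer[OF \<sigma>] \<sigma> top\<gamma>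
    by (auto simp: continuous_map_def topology_coarser_def mixed_candidate_def linear_topology_def)
  have "linear_topology scaleK \<gamma>"
    unfolding linear_topology_def
  proof (intro conjI top\<gamma> into)
    fix \<sigma> assume \<sigma>: "mixed_candidate scaleK \<tau> \<sigma>"
    then have l: "linear_topology scaleK \<sigma>" by (simp add: mixed_candidate_def)
    have "continuous_map (prod_topology \<gamma> \<gamma>) (prod_topology \<sigma> \<sigma>) (\<lambda>(x, y). (x, y))"
      using id\<sigma>[OF \<sigma>]
      by (intro iffD2[OF continuous_map_prod_top] disjI2 conjI) auto
    from continuous_map_compose[OF this, of \<sigma> "\<lambda>(x, y). x + y"]
    show "continuous_map (prod_topology \<gamma> \<gamma>) \<sigma> (\<lambda>(x, y). x + y)"
      using l by (simp add: linear_topology_def o_def case_prod_unfold)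
    have "continuous_map (prod_topology euclidean \<gamma>) (prod_topology euclidean \<sigma>)
            (\<lambda>(c::'k, x). (c, x))"
      using id\<sigma>[OF \<sigma>]
      by (intro iffD2[OF continuous_map_prod_top] disjI2 conjI) auto
    from continuous_map_compose[OF this, of \<sigma> "\<lambda>(c, x). scaleK c x"]
    show "continuous_map (prod_topology euclidean \<gamma>) \<sigma> (\<lambda>(c, x). scaleK c x)"
      using l by (simp add: linear_topology_def o_def case_prod_unfold)
  qed
  moreover have "subtopology \<gamma> B = subtopology \<tau> B" if B: "bounded B" for B
  proof -
    have top\<tau>: "topspace \<tau> = UNIV" using lin by (simp add: linear_topology_def)
    have "continuous_map (subtopology \<tau> B) \<gamma> (\<lambda>x. x)"
    proof (rule into)
      fix \<sigma> assume \<sigma>: "mixed_candidate scaleK \<tau> \<sigma>"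
      then have "subtopology \<sigma> B = subtopology \<tau> B"
        using B by (simp add: mixed_candidate_def)
      then show "continuous_map (subtopology \<tau> B) \<sigma> (\<lambda>x. x)"
        using continuous_map_from_subtopology[OF continuous_map_id, of \<sigma> B] by (simp add: id_def)
    qed
    then have "openin (subtopology \<tau> B) (B \<inter> U)" if "openin \<gamma> U" for U
      using openin_continuous_map_preimage[of "subtopology \<tau> B" \<gamma> "\<lambda>x. x" U] that top\<tau>
      by (simp add: Int_def conj_commute)
    moreover have "openin (subtopology \<gamma> B) (B \<inter> U)" if "openin \<tau> U" for U
      using finer[OF \<tau>] that
      by (auto simp: topology_coarser_def openin_subtopology)
    ultimately show ?thesis
      unfolding topology_eq openin_subtopology by (metis Int_commute)
  qed
  moreover have "topology_coarser \<gamma> euclidean"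
  proof -
    have "continuous_map euclidean \<gamma> (\<lambda>x. x)"
      by (rule into)
        (auto simp: continuous_map_def mixed_candidate_def topology_coarser_def linear_topology_def)
    then show ?thesis
      unfolding topology_coarser_def
      using openin_continuous_map_preimage[of euclidean \<gamma> "\<lambda>x. x"] by auto
  qed
  ultimately have cand: "mixed_candidate scaleK \<tau> \<gamma>"
    using finer[OF \<tau>] by (auto simp: mixed_candidate_def)
  show ?thesis
  proof (rule ex1I[of _ \<gamma>])
    show "mixed_candidate scaleK \<tau> \<gamma> \<and>
        (\<forall>\<sigma>. mixed_candidate scaleK \<tau> \<sigma> \<longrightarrow> topology_coarser \<sigma> \<gamma>)"
      using cand finer by blast
    show "\<delta> = \<gamma>" if "mixed_candidate scaleK \<tau> \<delta> \<and>
        (\<forall>\<sigma>. mixed_candidate scaleK \<tau> \<sigma> \<longrightarrow> topology_coarser \<sigma> \<delta>)" for \<delta>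
      using that cand finer unfolding topology_eq topology_coarser_def by blast
  qed
qed

section \<open>Saks spaces\<close>

definition seminorm_over ::
  "('k::real_normed_field \<Rightarrow> 'a::banach \<Rightarrow> 'a) \<Rightarrow> ('a \<Rightarrow> real) \<Rightarrow> bool" where
  "seminorm_over scaleK p \<longleftrightarrow>
     (\<forall>x y. p (x + y) \<le> p x + p y) \<and> (\<forall>c x. p (scaleK c x) = norm c * p x)"

definition directed_seminorms :: "('a \<Rightarrow> real) set \<Rightarrow> bool" where
  "directed_seminorms P \<longleftrightarrow> P \<noteq> {} \<and>
     (\<forall>p\<in>P. \<forall>q\<in>P. \<exists>r\<in>P. \<exists>C\<ge>0. \<forall>x. max (p x) (q x) \<le> C * r x)"

text \<open>Balls of a single seminorm form a neighbourhood base, since the systems of seminorms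
  considered are directed.\<close>

definition generates_topology :: "('a::banach \<Rightarrow> real) set \<Rightarrow> 'a topology \<Rightarrow> bool" where
  "generates_topology P \<tau> \<longleftrightarrow>
     (\<forall>U. openin \<tau> U \<longleftrightarrow> (\<forall>x\<in>U. \<exists>p\<in>P. \<exists>e>0. {y. p (y - x) < e} \<subseteq> U))"

definition saks_space ::
  "('k::real_normed_field \<Rightarrow> 'a::banach \<Rightarrow> 'a) \<Rightarrow> 'a topology \<Rightarrow> bool" where
  "saks_space scaleK \<tau> \<longleftrightarrow>
     Hausdorff_space \<tau> \<and> locally_convex_topology scaleK \<tau> \<and> topology_coarser \<tau> euclidean \<and>
     (\<exists>P. (\<forall>p\<in>P. seminorm_over scaleK p) \<and> directed_seminorms P \<and> generates_topology P \<tau> \<and>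
        (\<forall>x. bdd_above ((\<lambda>p. p x) ` P) \<and> norm x = (SUP p\<in>P. p x)))"

definition sequentially_complete_saks_space ::
  "('k::real_normed_field \<Rightarrow> 'a::banach \<Rightarrow> 'a) \<Rightarrow> 'a topology \<Rightarrow> bool" where
  "sequentially_complete_saks_space scaleK \<tau> \<longleftrightarrow>
     saks_space scaleK \<tau> \<and> sequentially_complete_in (mixed_topology scaleK \<tau>) UNIV"

definition mazur_saks_space ::
  "('k::real_normed_field \<Rightarrow> 'a::banach \<Rightarrow> 'a) \<Rightarrow> 'a topology \<Rightarrow> bool" where
  "mazur_saks_space scaleK \<tau> \<longleftrightarrow> saks_space scaleK \<tau> \<and>
     (\<forall>f :: 'a \<Rightarrow> 'k. Vector_Spaces.linear scaleK (*) f \<and>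
        (\<forall>s l. limitin (mixed_topology scaleK \<tau>) s l sequentially \<longrightarrow> (\<lambda>n. f (s n)) \<longlonglongrightarrow> f l)
        \<longrightarrow> continuous_map (mixed_topology scaleK \<tau>) euclidean f)"

section \<open>The space \<open>X\<^sup>\<circ>\<close> and d-consistency\<close>

text \<open>The norm of \<^typ>\<open>'a \<Rightarrow>\<^sub>L 'k\<close> is the operator norm; its elements are only real-linear, hence
  the extra linearity condition.\<close>

definition norm_dual ::
  "('k::real_normed_field \<Rightarrow> 'a::banach \<Rightarrow> 'a) \<Rightarrow> ('a \<Rightarrow>\<^sub>L 'k) set" where
  "norm_dual scaleK = {f. Vector_Spaces.linear scaleK (*) (blinfun_apply f)}"

definition circ_dual ::
  "('k::real_normed_field \<Rightarrow> 'a::banach \<Rightarrow> 'a) \<Rightarrow> 'a topology \<Rightarrow> ('a \<Rightarrow>\<^sub>L 'k) set" where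
  "circ_dual scaleK \<tau> = {f \<in> norm_dual scaleK.
     \<forall>B. bounded B \<longrightarrow> (\<forall>s l. range s \<subseteq> B \<and> l \<in> B \<and> limitin \<tau> s l sequentially
       \<longrightarrow> (\<lambda>n. blinfun_apply f (s n)) \<longlonglongrightarrow> blinfun_apply f l)}"

text \<open>The weak topology \<open>\<sigma>(X\<^sup>\<circ>, X)\<close>, i.e. the topology of pointwise convergence on \<open>X\<close>.\<close>

definition weak_circ_topology ::
  "('k::real_normed_field \<Rightarrow> 'a::banach \<Rightarrow> 'a) \<Rightarrow> 'a topology \<Rightarrow> ('a \<Rightarrow>\<^sub>L 'k) topology" where
  "weak_circ_topology scaleK \<tau> =
     pullback_topology (circ_dual scaleK \<tau>) blinfun_apply (product_topology (\<lambda>_. euclidean) UNIV)"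

definition equicontinuous_on_bounded ::
  "'a::banach topology \<Rightarrow> ('a \<Rightarrow>\<^sub>L 'k::real_normed_field) set \<Rightarrow> bool" where
  "equicontinuous_on_bounded \<tau> F \<longleftrightarrow>
     (\<forall>B. bounded B \<longrightarrow> (\<forall>x\<in>B. \<forall>e>0. \<exists>U. openin (subtopology \<tau> B) U \<and> x \<in> U \<and>
        (\<forall>f\<in>F. \<forall>y\<in>U. norm (blinfun_apply f y - blinfun_apply f x) < e)))"

definition d_consistent ::
  "('k::real_normed_field \<Rightarrow> 'a::banach \<Rightarrow> 'a) \<Rightarrow> 'a topology \<Rightarrow> bool" where
  "d_consistent scaleK \<tau> \<longleftrightarrow>
     sequentially_complete_in (weak_circ_topology scaleK \<tau>) {f \<in> circ_dual scaleK \<tau>. norm f \<le> 1} \<and>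
     (\<forall>f. range f \<subseteq> circ_dual scaleK \<tau> \<and> bounded (range f) \<and>
        limitin (weak_circ_topology scaleK \<tau>) f 0 sequentially
        \<longrightarrow> equicontinuous_on_bounded \<tau> (range f))"

section \<open>Bi-continuous semigroups and the bi-sun dual\<close>

text \<open>A semigroup is indexed by \<^typ>\<open>real\<close>; its values at negative times play no role. Local
  uniformity in time is uniformity on each interval \<open>[0, t\<^sub>0]\<close>.\<close>

definition bicontinuous_semigroup ::
  "('k::real_normed_field \<Rightarrow> 'a::banach \<Rightarrow> 'a) \<Rightarrow> 'a topology \<Rightarrow> (real \<Rightarrow> 'a \<Rightarrow>\<^sub>L 'a) \<Rightarrow> bool" where
  "bicontinuous_semigroup scaleK \<tau> T \<longleftrightarrow>
     (\<forall>t\<ge>0. Vector_Spaces.linear scaleK scaleK (blinfun_apply (T t))) \<and>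
     T 0 = id_blinfun \<and> (\<forall>t\<ge>0. \<forall>s\<ge>0. T (t + s) = T t o\<^sub>L T s) \<and>
     (\<forall>x. continuous_map (top_of_set {0..}) (mixed_topology scaleK \<tau>) (\<lambda>t. blinfun_apply (T t) x)) \<and>
     (\<forall>s x. limitin (mixed_topology scaleK \<tau>) s x sequentially \<longrightarrow>
        (\<forall>t\<^sub>0\<ge>0. \<forall>U. openin (mixed_topology scaleK \<tau>) U \<and> 0 \<in> U \<longrightarrow>
           (\<exists>N. \<forall>n\<ge>N. \<forall>t\<in>{0..t\<^sub>0}. blinfun_apply (T t) (s n - x) \<in> U)))"

text \<open>The dual operator of \<open>T t\<close> maps \<open>f\<close> to \<open>f o\<^sub>L T t\<close>.\<close>

definition bisun_dual ::
  "('k::real_normed_field \<Rightarrow> 'a::banach \<Rightarrow> 'a) \<Rightarrow> 'a topology \<Rightarrow> (real \<Rightarrow> 'a \<Rightarrow>\<^sub>L 'a) \<Rightarrow> ('a \<Rightarrow>\<^sub>L 'k) set"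
  where
  "bisun_dual scaleK \<tau> T =
     {f \<in> circ_dual scaleK \<tau>. ((\<lambda>t. norm ((f o\<^sub>L T t) - f)) \<longlongrightarrow> 0) (at_right 0)}"

definition bisun_norm ::
  "('k::real_normed_field \<Rightarrow> 'a::banach \<Rightarrow> 'a) \<Rightarrow> 'a topology \<Rightarrow> (real \<Rightarrow> 'a \<Rightarrow>\<^sub>L 'a) \<Rightarrow> 'a \<Rightarrow> real"
  where
  "bisun_norm scaleK \<tau> T x =
     (SUP f\<in>{f \<in> bisun_dual scaleK \<tau> T. norm f \<le> 1}. norm (blinfun_apply f x))"

definition norm_over ::
  "('k::real_normed_field \<Rightarrow> 'a::banach \<Rightarrow> 'a) \<Rightarrow> ('a \<Rightarrow> real) \<Rightarrow> bool" where
  "norm_over scaleK N \<longleftrightarrow> seminorm_over scaleK N \<and> (\<forall>x. N x = 0 \<longrightarrow> x = 0)"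

definition equivalent_norms ::
  "('k::real_normed_field \<Rightarrow> 'a::banach \<Rightarrow> 'a) \<Rightarrow> ('a \<Rightarrow> real) \<Rightarrow> ('a \<Rightarrow> real) \<Rightarrow> bool" where
  "equivalent_norms scaleK N\<^sub>1 N\<^sub>2 \<longleftrightarrow> norm_over scaleK N\<^sub>1 \<and> norm_over scaleK N\<^sub>2 \<and>
     (\<exists>c>0. \<exists>C>0. \<forall>x. c * N\<^sub>2 x \<le> N\<^sub>1 x \<and> N\<^sub>1 x \<le> C * N\<^sub>2 x)"

end

theory Submission
  imports Defs
begin

text \<open>One inequality is immediate, since the supremum defining \<open>\<parallel>x\<parallel>\<^sup>\<bullet>\<close> is taken over functionals of
  norm at most one.  For the other, let \<open>M \<ge> 1\<close> bound the norms \<open>\<parallel>T(t)\<parallel>\<close> for \<open>t\<close> in \<open>[0, 1]\<close>; the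
  claim is \<open>\<parallel>x\<parallel> \<le> M \<parallel>x\<parallel>\<^sup>\<bullet>\<close>.

  The unit ball of \<open>X\<^sup>\<circ>\<close> recovers the norm (\<open>circ_dual_norming\<close>): the norm is a supremum of
  \<open>\<tau>\<close>-continuous seminorms \<open>p\<close>, and by the Hahn--Banach theorem there is a functional dominated by
  \<open>p\<close> whose modulus at \<open>x\<close> is \<open>p x\<close>.  So it is enough to bound \<open>\<bar>\<langle>f, x\<rangle>\<bar>\<close> for \<open>f\<close> in the unit ball
  of \<open>X\<^sup>\<circ>\<close>.  The functionals
  \<open>x \<mapsto> (1 / t) \<integral>\<^sub>0\<^sup>t \<langle>f, T(s) x\<rangle> ds\<close> with \<open>0 < t \<le> 1\<close> have norm at most \<open>M\<close> and converge to \<open>f\<close> pointwise as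
  \<open>t\<close> tends to zero (\<open>orbit_mean_approx\<close>).  They belong to \<open>X\<^sup>\<circ>\<close>, because \<open>f\<close> is \<open>\<gamma>\<close>-continuous by
  the Mazur property and convergence in \<open>\<gamma>\<close> is preserved uniformly in \<open>s\<close> by the semigroup, and
  averaging makes their orbits under the dual semigroup norm continuous, so that they belong to the
  bi-sun dual (\<open>orbit_mean_in_bisun_dual\<close>).  Hence \<open>\<bar>\<langle>f, x\<rangle>\<bar> \<le> M \<parallel>x\<parallel>\<^sup>\<bullet>\<close>.

  Both the existence of \<open>M\<close> and the passage between \<open>\<tau>\<close> and \<open>\<gamma>\<close> rest on the fact that
  \<open>\<gamma>\<close>-convergent sequences are norm bounded (\<open>bounded_if_limitin_\<gamma>\<close>).  This uses the maximality
  of \<open>\<gamma>\<close>: a seminorm that is at most the norm and \<open>\<tau>\<close>-continuous at zero on bounded sets is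
  \<open>\<gamma>\<close>-continuous.\<close>

section \<open>Dominated functionals on spaces over the real or complex numbers\<close>

definition sublinear :: "('a::real_vector \<Rightarrow> real) \<Rightarrow> bool" where
  "sublinear q \<longleftrightarrow> (\<forall>x y. q (x + y) \<le> q x + q y) \<and> (\<forall>c\<ge>0. \<forall>x. q (c *\<^sub>R x) = c * q x)"

lemma sublinear_add: "sublinear q \<Longrightarrow> q (x + y) \<le> q x + q y"
  and sublinear_scale: "sublinear q \<Longrightarrow> 0 \<le> c \<Longrightarrow> q (c *\<^sub>R x) = c * q x"
  by (auto simp: sublinear_def)

lemma sublinear_zero: "sublinear q \<Longrightarrow> q 0 = 0"
  using sublinear_scale[of q 0 0] by simp

lemma sublinear_minus_le: "sublinear q \<Longrightarrow> - q (- x) \<le> q x"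
  using sublinear_add[of q x "- x"] sublinear_zero[of q] by simp

text \<open>This is the largest sublinear functional below \<open>q\<close> whose value at \<open>- z\<close> is at most
  \<open>- q z\<close>, so a sublinear functional that is minimal has to be odd and additive.\<close>

definition sublinear_descent :: "('a::real_vector \<Rightarrow> real) \<Rightarrow> 'a \<Rightarrow> 'a \<Rightarrow> real" where
  "sublinear_descent q z x = (INF t\<in>{0..}. q (x + t *\<^sub>R z) - t * q z)"

lemma sublinear_descent_le:
  assumes q: "sublinear q" and t: "0 \<le> t"
  shows "sublinear_descent q z x \<le> q (x + t *\<^sub>R z) - t * q z"
  unfolding sublinear_descent_def
proof (rule cINF_lower)
  have "- q (- x) \<le> q (x + t *\<^sub>R z) - t * q z" if "0 \<le> t" for t
    using sublinear_add[OF q, of "x + t *\<^sub>R z" "- x"] sublinear_scale[OF q that, of z] by simp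
  then show "bdd_below ((\<lambda>t. q (x + t *\<^sub>R z) - t * q z) ` {0..})"
    by (intro bdd_belowI2) auto
qed (use t in auto)

lemma sublinear_descent_greatest:
  assumes "\<And>t. 0 \<le> t \<Longrightarrow> m \<le> q (x + t *\<^sub>R z) - t * q z"
  shows "m \<le> sublinear_descent q z x"
  unfolding sublinear_descent_def by (rule cINF_greatest) (use assms in auto)

lemma sublinear_descent_le_self:
  assumes "sublinear q"
  shows "sublinear_descent q z x \<le> q x"
  using sublinear_descent_le[OF assms, of 0] by simp

lemma sublinear_sublinear_descent:
  assumes q: "sublinear q"
  shows "sublinear (sublinear_descent q z)"
  unfolding sublinear_def
proof (intro conjI allI impI)
  let ?d = "sublinear_descent q z"
  fix x y
  have two: "?d (x + y) \<le> (q (x + s *\<^sub>R z) - s * q z) + (q (y + t *\<^sub>R z) - t * q z)"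
    if st: "0 \<le> s" "0 \<le> t" for s t
  proof -
    have "q (x + y + (s + t) *\<^sub>R z) \<le> q (x + s *\<^sub>R z) + q (y + t *\<^sub>R z)"
      using sublinear_add[OF q, of "x + s *\<^sub>R z" "y + t *\<^sub>R z"] by (simp add: algebra_simps)
    then show ?thesis
      using sublinear_descent_le[OF q, of "s + t" z "x + y"] st by (simp add: algebra_simps)
  qed
  have "?d (x + y) - (q (x + s *\<^sub>R z) - s * q z) \<le> ?d y" if "0 \<le> s" for s
    by (rule sublinear_descent_greatest) (use two[OF that] in \<open>simp add: algebra_simps\<close>)
  then have "?d (x + y) - ?d y \<le> ?d x"
    by (intro sublinear_descent_greatest) (simp add: algebra_simps)
  then show "?d (x + y) \<le> ?d x + ?d y" by simp
next
  let ?d = "sublinear_descent q z"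
  fix c :: real and x assume c: "0 \<le> c"
  have half: "?d (c *\<^sub>R x) \<le> c * ?d x" if c: "0 < c" for c x
  proof -
    have "?d (c *\<^sub>R x) / c \<le> q (x + t *\<^sub>R z) - t * q z" if t: "0 \<le> t" for t
    proof -
      have "q (c *\<^sub>R x + (c * t) *\<^sub>R z) = c * q (x + t *\<^sub>R z)"
        using sublinear_scale[OF q, of c "x + t *\<^sub>R z"] c by (simp add: algebra_simps)
      then show ?thesis
        using sublinear_descent_le[OF q, of "c * t" z "c *\<^sub>R x"] c t by (simp add: field_simps)
    qed
    then have "?d (c *\<^sub>R x) / c \<le> ?d x" by (rule sublinear_descent_greatest)
    then show ?thesis using c by (simp add: field_simps)
  qed
  show "?d (c *\<^sub>R x) = c * ?d x"
  proof (cases "c = 0")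
    case True
    have "q (t *\<^sub>R z) = t * q z" if "0 \<le> t" for t by (rule sublinear_scale[OF q that])
    then show ?thesis
      using True sublinear_descent_greatest[of 0 q 0 z] sublinear_descent_le_self[OF q, of z 0]
      by (auto simp: sublinear_zero[OF q])
  next
    case False
    then have c: "0 < c" using c by simp
    have "?d x \<le> (1 / c) * ?d (c *\<^sub>R x)" using half[of "1 / c" "c *\<^sub>R x"] c by simp
    then have "c * ?d x \<le> ?d (c *\<^sub>R x)" using c by (simp add: field_simps)
    then show ?thesis using half[OF c, of x] by simp
  qed
qed

text \<open>Zorn's lemma applies because the members of a chain below \<open>p\<close> are bounded below by
  \<open>x \<mapsto> - p (- x)\<close>, and the pointwise infimum of a chain is subadditive: of two members, the smaller
  one serves for both arguments.\<close>

lemma minimal_sublinear_below: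
  assumes p: "sublinear p"
  obtains q where "sublinear q" "\<And>x. q x \<le> p x"
    "\<And>r. sublinear r \<Longrightarrow> (\<And>x. r x \<le> q x) \<Longrightarrow> r = q"
proof -
  define A where "A = {q. sublinear q \<and> q \<le> p}"
  let ?P = "\<lambda>a b :: 'a \<Rightarrow> real. b \<le> a"
  have "\<exists>m\<in>A. \<forall>a\<in>A. ?P m a \<longrightarrow> a = m"
  proof (rule predicate_Zorn)
    show "partial_order_on A (relation_of ?P A)"
      by (rule partial_order_on_relation_ofI) auto
    fix C assume C: "C \<in> Chains (relation_of ?P A)"
    have CA: "C \<subseteq> A" and tot: "\<And>a b. a \<in> C \<Longrightarrow> b \<in> C \<Longrightarrow> a \<le> b \<or> b \<le> a"
      using C by (auto simp: Chains_def relation_of_def)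
    show "\<exists>u\<in>A. \<forall>a\<in>C. u \<le> a"
    proof (cases "C = {}")
      case True
      then show ?thesis using p by (auto simp: A_def)
    next
      case False
      define u where "u x = (INF q\<in>C. q x)" for x
      have "- p (- x) \<le> q x" if "q \<in> C" for q x
      proof -
        have "sublinear q" "q (- x) \<le> p (- x)" using that CA by (auto simp: A_def le_fun_def)
        then show ?thesis using sublinear_minus_le[of q x] by simp
      qed
      then have bdd: "bdd_below ((\<lambda>q. q x) ` C)" for x by (intro bdd_belowI2)
      have u_le: "u x \<le> q x" if "q \<in> C" for q x
        unfolding u_def using bdd that by (rule cINF_lower)
      have u_ge: "m \<le> u x" if "\<And>q. q \<in> C \<Longrightarrow> m \<le> q x" for m x
        unfolding u_def using False that by (rule cINF_greatest)
      have sub: "sublinear q" if "q \<in> C" for q using that CA by (auto simp: A_def)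
      have "u (x + y) \<le> u x + u y" for x y
      proof -
        have two: "u (x + y) \<le> a x + b y" if ab: "a \<in> C" "b \<in> C" for a b
        proof -
          obtain q where q: "q \<in> C" "q \<le> a" "q \<le> b" using tot[OF ab] ab by auto
          have "u (x + y) \<le> q x + q y" 
            using u_le[OF q(1)] sublinear_add[OF sub[OF q(1)]] by (meson order_trans)
          also have "\<dots> \<le> a x + b y" using q by (simp add: le_fun_def add_mono)
          finally show ?thesis .
        qed
        have "u (x + y) - a x \<le> u y" if "a \<in> C" for a
          by (rule u_ge) (use two[OF that] in \<open>simp add: algebra_simps\<close>)
        then have "u (x + y) - u y \<le> u x" by (intro u_ge) (simp add: algebra_simps)
        then show ?thesis by simp
      qed
      moreover have "u (c *\<^sub>R x) = c * u x" if c: "0 \<le> c" for c x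
      proof (cases "c = 0")
        case True
        obtain q where q: "q \<in> C" using False by blast
        then have "u 0 \<le> 0" using u_le[of q 0] sublinear_zero[OF sub[OF q]] by simp
        moreover have "0 \<le> u 0"
          by (rule u_ge) (metis sub sublinear_zero order_refl)
        ultimately show ?thesis using True by simp
      next
        case c0: False
        have half: "u (c *\<^sub>R x) \<le> c * u x" if c: "0 < c" for c x
        proof -
          have "u (c *\<^sub>R x) / c \<le> q x" if "q \<in> C" for q
            using u_le[OF that, of "c *\<^sub>R x"] sublinear_scale[OF sub[OF that], of c x] c
            by (simp add: field_simps)
          then have "u (c *\<^sub>R x) / c \<le> u x" by (rule u_ge)
          then show ?thesis using c by (simp add: field_simps)
        qed
        have "0 < c" using c c0 by simp
        moreover have "u x \<le> (1 / c) * u (c *\<^sub>R x)" using half[of "1 / c" "c *\<^sub>R x"] c c0 by simp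
        ultimately show ?thesis using half[of c x] by (simp add: field_simps)
      qed
      ultimately have "sublinear u" by (simp add: sublinear_def)
      moreover have "u \<le> p"
      proof -
        obtain q where "q \<in> C" using False by blast
        then have "u \<le> q" "q \<le> p" using CA u_le by (auto simp: A_def le_fun_def)
        then show ?thesis by (rule order_trans)
      qed
      ultimately show ?thesis using u_le by (auto simp: A_def le_fun_def)
    qed
  qed
  then obtain q where "q \<in> A" "\<forall>a\<in>A. a \<le> q \<longrightarrow> a = q" by blast
  then have q: "sublinear q" "\<And>x. q x \<le> p x"
    and min: "\<And>a. a \<in> A \<Longrightarrow> a \<le> q \<Longrightarrow> a = q"
    by (auto simp: A_def le_fun_def)
  have "r = q" if r: "sublinear r" "\<And>x. r x \<le> q x" for r
  proof (rule min)
    have "r x \<le> p x" for x using r(2) q(2) by (rule order_trans)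
    then show "r \<in> A" using r(1) by (simp add: A_def le_fun_def)
    show "r \<le> q" using r(2) by (simp add: le_fun_def)
  qed
  with q show ?thesis by (rule that)
qed

text \<open>The functional comes from a minimal sublinear functional below the descent of \<open>p\<close> in the
  direction \<open>z\<close>.  Minimality makes it equal to each of its own descents, which turns
  subadditivity into additivity; the initial descent forces the value at \<open>z\<close>.\<close>

lemma real_dominated_functional:
  assumes p: "sublinear p"
  obtains u :: "'a::real_vector \<Rightarrow> real" where "linear u" "\<And>x. u x \<le> p x" "u z = p z"
proof -
  obtain u where u: "sublinear u" and le: "\<And>x. u x \<le> sublinear_descent p z x"
    and min: "\<And>r. sublinear r \<Longrightarrow> (\<And>x. r x \<le> u x) \<Longrightarrow> r = u"
    using minimal_sublinear_below[OF sublinear_sublinear_descent[OF p]] by blast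
  have desc: "sublinear_descent u y = u" for y
    using sublinear_sublinear_descent[OF u] sublinear_descent_le_self[OF u] by (rule min)
  have add: "u (x + y) = u x + u y" for x y
    using sublinear_descent_le[OF u, of 1 y x] desc[of y] sublinear_add[OF u, of x y] by simp
  have neg: "u (- x) = - u x" for x
    using add[of x "- x"] sublinear_zero[OF u] by simp
  have "u (c *\<^sub>R x) = c * u x" for c x
  proof (cases "0 \<le> c")
    case True
    then show ?thesis by (rule sublinear_scale[OF u])
  next
    case False
    then have "u ((- c) *\<^sub>R x) = - c * u x" by (intro sublinear_scale[OF u]) simp
    then show ?thesis using neg[of "c *\<^sub>R x"] by simp
  qed
  then have "linear u" by (intro linearI) (auto simp: add)
  moreover have up: "u x \<le> p x" for x
    using le[of x] sublinear_descent_le_self[OF p, of z x] by simp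
  moreover have "u z = p z"
  proof -
    have "u (- z) \<le> - p z"
      using le[of "- z"] sublinear_descent_le[OF p, of 1 z "- z"] sublinear_zero[OF p] by simp
    then show ?thesis using neg[of z] up[of z] by simp
  qed
  ultimately show ?thesis using that by blast
qed

lemma seminorm_over_add: "seminorm_over scaleK p \<Longrightarrow> p (x + y) \<le> p x + p y"
  and seminorm_over_scale: "seminorm_over scaleK p \<Longrightarrow> p (scaleK c x) = norm c * p x"
  by (auto simp: seminorm_over_def)

context banach_space_over
begin

lemma seminorm_over_scaleR: "seminorm_over scaleK p \<Longrightarrow> p (r *\<^sub>R x) = \<bar>r\<bar> * p x"
  using seminorm_over_scale[of scaleK p "of_real r" x] by (simp add: scale_of_real)

lemma seminorm_over_zero: "seminorm_over scaleK p \<Longrightarrow> p 0 = 0"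
  using seminorm_over_scaleR[of p 0 0] by simp

lemma seminorm_over_minus: "seminorm_over scaleK p \<Longrightarrow> p (- x) = p x"
  using seminorm_over_scaleR[of p "-1" x] by simp

lemma seminorm_over_nonneg: "seminorm_over scaleK p \<Longrightarrow> 0 \<le> p x"
  using seminorm_over_add[of scaleK p x "- x"] seminorm_over_zero[of p] seminorm_over_minus[of p x]
  by simp

lemma seminorm_over_norm: "seminorm_over scaleK norm"
  by (simp add: seminorm_over_def norm_triangle_ineq norm_scale)

end

text \<open>A complex number is determined to be the real \<open>r\<close> by its distances \<open>\<bar>r\<bar>\<close> and \<open>\<bar>r - 1\<bar>\<close> from
  \<open>0\<close> and \<open>1\<close>, and an isometric isomorphism preserves these distances.\<close>

lemma normed_field_iso_of_real_complex:
  fixes \<phi> :: "'k::real_normed_field \<Rightarrow> complex"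
  assumes "normed_field_iso \<phi>"
  shows "\<phi> (of_real r) = of_real r"
proof -
  have add: "\<phi> (a + b) = \<phi> a + \<phi> b" and mult: "\<phi> (a * b) = \<phi> a * \<phi> b"
    and nrm: "norm (\<phi> a) = norm a" for a b
    using assms by (auto simp: normed_field_iso_def)
  have one: "\<phi> 1 = 1"
    using mult[of 1 1] nrm[of 1] by auto
  have "norm (\<phi> (of_real r)) = \<bar>r\<bar>" by (simp add: nrm)
  moreover have "\<phi> (of_real (r - 1)) + 1 = \<phi> (of_real r)"
    using add[of "of_real (r - 1)" 1] by (simp add: one)
  then have "norm (\<phi> (of_real r) - 1) = \<bar>r - 1\<bar>"
    by (metis add_diff_cancel_right' nrm norm_of_real)
  ultimately have "(Re (\<phi> (of_real r)))\<^sup>2 + (Im (\<phi> (of_real r)))\<^sup>2 = r\<^sup>2"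
    "(Re (\<phi> (of_real r)) - 1)\<^sup>2 + (Im (\<phi> (of_real r)))\<^sup>2 = (r - 1)\<^sup>2"
    using cmod_power2[of "\<phi> (of_real r)"] cmod_power2[of "\<phi> (of_real r) - 1"] by auto
  then have "Re (\<phi> (of_real r)) = r" "Im (\<phi> (of_real r)) = 0"
    by (auto simp: power2_eq_square algebra_simps)
  then show ?thesis by (simp add: complex_eq_iff)
qed

text \<open>This eliminates the isomorphism: either all scalars are real, or there is an imaginary unit
  \<open>j\<close> in the scalar field itself.\<close>

lemma real_or_complex_cases:
  assumes "real_or_complex TYPE('k::real_normed_field)"
  obtains (real) "\<And>c::'k::real_normed_field. c \<in> range of_real"
  | (complex) j :: "'k::real_normed_field" where "j * j = -1"
      "\<And>c::'k::real_normed_field. \<exists>a b. c = of_real a + j * of_real b"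
      "\<And>a b. (norm (of_real a + j * of_real b))\<^sup>2 = a\<^sup>2 + b\<^sup>2"
proof -
  consider (r) \<phi> :: "'k \<Rightarrow> real" where "normed_field_iso \<phi>"
    | (c) \<phi> :: "'k \<Rightarrow> complex" where "normed_field_iso \<phi>"
    using assms by (auto simp: real_or_complex_def)
  then show ?thesis
  proof cases
    case r
    have add: "\<phi> (a + b) = \<phi> a + \<phi> b" and mult: "\<phi> (a * b) = \<phi> a * \<phi> b"
      and nrm: "norm (\<phi> a) = norm a" and inj: "inj \<phi>" for a b
      using r by (auto simp: normed_field_iso_def bij_def)
    have one: "\<phi> 1 = 1" using mult[of 1 1] nrm[of 1] by auto
    have "\<phi> (of_real s) = s" for s
    proof -
      have "\<phi> (of_real (s - 1)) + 1 = \<phi> (of_real s)"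
        using add[of "of_real (s - 1)" 1] by (simp add: one)
      moreover have "\<bar>\<phi> (of_real s)\<bar> = \<bar>s\<bar>" "\<bar>\<phi> (of_real (s - 1))\<bar> = \<bar>s - 1\<bar>"
        using nrm[of "of_real s"] nrm[of "of_real (s - 1)"] by (simp_all del: of_real_diff)
      ultimately show ?thesis by linarith
    qed
    then have "c = of_real (\<phi> c)" for c using inj by (metis injD)
    then show ?thesis using real by blast
  next
    case c
    have add: "\<phi> (a + b) = \<phi> a + \<phi> b" and mult: "\<phi> (a * b) = \<phi> a * \<phi> b"
      and nrm: "norm (\<phi> a) = norm a" and bij: "bij \<phi>" for a b
      using c by (auto simp: normed_field_iso_def)
    note re = normed_field_iso_of_real_complex[OF c]
    obtain j where j: "\<phi> j = \<i>" using bij by (metis bij_pointE)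
    have val: "\<phi> (of_real a + j * of_real b) = Complex a b" for a b
      by (simp add: add mult re j complex_eq_iff)
    show ?thesis
    proof (rule complex[of j])
      have "\<phi> (j * j) = \<phi> (of_real (-1))" using re[of "-1"] by (simp add: mult j)
      then show "j * j = -1" using bij by (simp add: bij_def inj_def)
      show "\<exists>a b. d = of_real a + j * of_real b" for d
      proof (intro exI)
        have "\<phi> d = \<phi> (of_real (Re (\<phi> d)) + j * of_real (Im (\<phi> d)))" by (simp add: val)
        then show "d = of_real (Re (\<phi> d)) + j * of_real (Im (\<phi> d))"
          using bij by (simp add: bij_def inj_def)
      qed
      show "(norm (of_real a + j * of_real b))\<^sup>2 = a\<^sup>2 + b\<^sup>2" for a b
        using nrm[of "of_real a + j * of_real b"] by (simp add: val flip: cmod_power2)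
          (metis cmod_power2 complex.sel)
    qed
  qed
qed

lemma (in banach_space_over) linear_over_iff:
  "Vector_Spaces.linear scaleK (*) f \<longleftrightarrow>
     (\<forall>x y. f (x + y) = f x + f y) \<and> (\<forall>c x. f (scaleK c x) = c * f x)"
  by (auto simp: Vector_Spaces.linear_iff vector_space_axioms vector_space_def algebra_simps)

text \<open>Over the complex scalars a real functional \<open>u\<close> is the real part of the complex functional
  \<open>x \<mapsto> u x - \<i> u (\<i> x)\<close>.  Rotating \<open>x\<close> by the phase of the value at \<open>x\<close> makes this value real,
  hence a value of \<open>u\<close>, so the bound by \<open>p\<close> carries over.\<close>

lemma (in banach_space_over) dominated_functional:
  assumes roc: "real_or_complex TYPE('k)" and p: "seminorm_over scaleK p"
  obtains f where "Vector_Spaces.linear scaleK (*) f" "\<And>x. norm (f x) \<le> p x" "norm (f z) = p z"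
proof -
  have "sublinear p"
    using seminorm_over_add[OF p] seminorm_over_scaleR[OF p] by (auto simp: sublinear_def)
  from real_dominated_functional[OF this, of z]
  obtain u where u: "linear u" "\<And>x. u x \<le> p x" "u z = p z" by blast
  have abs_u: "\<bar>u x\<bar> \<le> p x" for x
    using u(2)[of x] u(2)[of "- x"] linear_neg[OF u(1), of x] seminorm_over_minus[OF p, of x] by simp
  show ?thesis
    using roc
  proof (cases rule: real_or_complex_cases)
    case real
    define f :: "'a \<Rightarrow> 'k" where "f x = of_real (u x)" for x
    have "f (scaleK c x) = c * f x" for c x
    proof -
      obtain r where "c = of_real r" using real by blast
      then show ?thesis by (simp add: f_def scale_of_real linear_scale[OF u(1)])
    qed
    then have "Vector_Spaces.linear scaleK (*) f"
      by (simp add: linear_over_iff f_def linear_add[OF u(1)])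
    moreover have "norm (f x) \<le> p x" for x using abs_u by (simp add: f_def)
    moreover have "norm (f z) = p z" using u(3) seminorm_over_nonneg[OF p, of z] by (simp add: f_def)
    ultimately show ?thesis by (rule that)
  next
    case (complex j)
    define f :: "'a \<Rightarrow> 'k" where "f x = of_real (u x) + j * of_real (- u (scaleK j x))" for x
    have add: "f (x + y) = f x + f y" for x y
      by (simp add: f_def linear_add[OF u(1)] scale_right_distrib algebra_simps)
    have jj: "scaleK j (scaleK j x) = - x" for x
      using complex(1) by (metis scale_scale scale_minus_left scale_one)
    have fr: "f (r *\<^sub>R x) = of_real r * f x" for r x
    proof -
      have "scaleK j (r *\<^sub>R x) = r *\<^sub>R scaleK j x"
        by (metis scale_left_commute scale_of_real)
      then show ?thesis by (simp add: f_def linear_scale[OF u(1)] algebra_simps)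
    qed
    have fj: "f (scaleK j x) = j * f x" for x
    proof -
      have "j * f x = j * of_real (u x) + (j * j) * of_real (- u (scaleK j x))"
        by (simp add: f_def algebra_simps)
      then show ?thesis
        by (simp add: f_def jj linear_neg[OF u(1)] complex(1))
    qed
    have sc: "f (scaleK c x) = c * f x" for c x
    proof -
      obtain a b where c: "c = of_real a + j * of_real b" using complex(2) by blast
      have "scaleK c x = a *\<^sub>R x + scaleK j (b *\<^sub>R x)"
        by (simp add: c scale_left_distrib scale_of_real flip: scale_scale)
      then show ?thesis by (simp add: add fr fj c algebra_simps)
    qed
    have lin: "Vector_Spaces.linear scaleK (*) f" by (simp add: linear_over_iff add sc)
    have u_le: "\<bar>u x\<bar> \<le> norm (f x)" for x
    proof -
      have "(u x)\<^sup>2 \<le> (norm (f x))\<^sup>2"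
        unfolding f_def complex(3) by simp
      then show ?thesis by (metis abs_le_square_iff abs_norm_cancel)
    qed
    have le: "norm (f x) \<le> p x" for x
    proof (cases "f x = 0")
      case True
      then show ?thesis using seminorm_over_nonneg[OF p] by simp
    next
      case False
      \<comment> \<open>the phase of \<open>f x\<close>, inverted\<close>
      define c where "c = of_real (norm (f x)) / f x"
      have c1: "norm c = 1" using False by (simp add: c_def norm_divide)
      have "f (scaleK c x) = of_real (norm (f x))" using False by (simp add: sc c_def)
      then have "of_real (u (scaleK c x) - norm (f x))
          + j * of_real (- u (scaleK j (scaleK c x))) = 0"
        unfolding f_def[of "scaleK c x"] of_real_diff by (simp only: algebra_simps) simp
      then have "(u (scaleK c x) - norm (f x))\<^sup>2 + (- u (scaleK j (scaleK c x)))\<^sup>2 = 0"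
        by (metis complex(3) norm_zero zero_power2)
      then have "norm (f x) = u (scaleK c x)" by (simp add: sum_power2_eq_zero_iff)
      also have "\<dots> \<le> p (scaleK c x)" by (rule u(2))
      also have "\<dots> = p x" by (simp add: seminorm_over_scale[OF p] c1)
      finally show ?thesis .
    qed
    have "norm (f z) = p z" using le[of z] u_le[of z] u(3) by linarith
    with lin le show ?thesis by (rule that)
  qed
qed

section \<open>Topologies generated by seminorms\<close>

lemma directed_seminorms_bound:
  assumes dir: "directed_seminorms P" and F: "finite F" "F \<subseteq> P" and nn: "\<And>p x. p \<in> P \<Longrightarrow> 0 \<le> p x"
  obtains r C where "r \<in> P" "0 < C" "\<And>p x. p \<in> F \<Longrightarrow> p x \<le> C * r x"
proof -
  have "\<exists>r\<in>P. \<exists>C>0. \<forall>p\<in>F. \<forall>x. p x \<le> C * r x"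
    using F
  proof (induction F)
    case empty
    obtain p where "p \<in> P" using dir by (auto simp: directed_seminorms_def)
    then show ?case by (intro bexI[of _ p] exI[of _ 1]) auto
  next
    case (insert p F)
    then obtain r C where r: "r \<in> P" "C > 0" "\<And>q x. q \<in> F \<Longrightarrow> q x \<le> C * r x" by auto
    obtain s D where s: "s \<in> P" "D \<ge> 0" "\<And>x. max (p x) (r x) \<le> D * s x"
      using dir r(1) insert.prems unfolding directed_seminorms_def by (meson insert_subset)
    have "q x \<le> (1 + C) * (D * s x)" if q: "q \<in> insert p F" for q x
    proof (cases "q = p")
      case True
      have "p x \<le> D * s x" "0 \<le> C * (D * s x)" using s(3)[of x] s(2) r(2) nn[OF s(1)] by auto
      then show ?thesis using True by (simp add: algebra_simps)
    next
      case False
      then have "q x \<le> C * r x" using r(3) q by auto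
      also have "\<dots> \<le> C * (D * s x)" using s(3)[of x] r(2) by simp
      also have "\<dots> \<le> (1 + C) * (D * s x)" using s(2) nn[OF s(1)] by (simp add: algebra_simps)
      finally show ?thesis .
    qed
    moreover have "(1 + C) * (D * s x) \<le> ((1 + C) * (D + 1)) * s x" for x
      using r(2) nn[OF s(1), of x] by (simp add: algebra_simps)
    ultimately have "\<forall>q\<in>insert p F. \<forall>x. q x \<le> ((1 + C) * (D + 1)) * s x"
      by (meson order_trans)
    moreover have "0 < (1 + C) * (D + 1)" using r(2) s(2) by simp
    ultimately show ?case using s(1) by blast
  qed
  then show ?thesis using that by blast
qed

lemma generates_topology_ball:
  assumes "generates_topology P \<tau>" "p \<in> P" and sub: "\<And>x y. p (x + y) \<le> p x + p y"
  shows "openin \<tau> {y. p (y - x) < e}"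
proof -
  have "{z. p (z - y) < e - p (y - x)} \<subseteq> {y. p (y - x) < e}" for y
    using sub[of "z - y" "y - x" for z] by (auto simp: algebra_simps) (smt (verit) diff_add_cancel)
  moreover have "e - p (y - x) > 0" if "p (y - x) < e" for y using that by simp
  ultimately show ?thesis
    using assms(1,2) unfolding generates_topology_def by (metis mem_Collect_eq)
qed

context banach_space_over
begin

lemma generates_topology_exists:
  assumes dir: "directed_seminorms Q" and semi: "\<And>q. q \<in> Q \<Longrightarrow> seminorm_over scaleK q"
  obtains \<sigma> where "generates_topology Q \<sigma>"
proof -
  define O' where "O' U \<longleftrightarrow> (\<forall>x\<in>U. \<exists>p\<in>Q. \<exists>e>0. {y. p (y - x) < e} \<subseteq> U)" for U
  have "istopology O'"
    unfolding istopology_def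
  proof (intro conjI allI impI)
    fix S T assume ST: "O' S" "O' T"
    show "O' (S \<inter> T)"
      unfolding O'_def
    proof
      fix x assume "x \<in> S \<inter> T"
      then obtain p e q d where p: "p \<in> Q" "e > 0" "{y. p (y - x) < e} \<subseteq> S"
        and q: "q \<in> Q" "d > 0" "{y. q (y - x) < d} \<subseteq> T"
        using ST unfolding O'_def by (metis IntE)
      obtain r C where r: "r \<in> Q" "0 < C" "\<And>f x. f \<in> {p, q} \<Longrightarrow> f x \<le> C * r x"
        using directed_seminorms_bound[OF dir, of "{p, q}"] p(1) q(1)
          seminorm_over_nonneg[OF semi] by (metis empty_subsetI finite.emptyI finite.insertI insert_subset)
      have "{y. r (y - x) < min e d / C} \<subseteq> S \<inter> T"
      proof
        fix y assume "y \<in> {y. r (y - x) < min e d / C}"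
        then have "C * r (y - x) < min e d" using r(2) by (simp add: field_simps)
        then have "p (y - x) < e" "q (y - x) < d"
          using r(3)[of p "y - x"] r(3)[of q "y - x"] by auto
        then show "y \<in> S \<inter> T" using p(3) q(3) by auto
      qed
      moreover have "min e d / C > 0" using p(2) q(2) r(2) by simp
      ultimately show "\<exists>p\<in>Q. \<exists>e>0. {y. p (y - x) < e} \<subseteq> S \<inter> T" using r(1) by blast
    qed
  next
    fix K assume "\<forall>S\<in>K. O' S"
    then show "O' (\<Union>K)" unfolding O'_def by (meson UnionE Union_upper order_trans)
  qed
  then have "openin (topology O') U \<longleftrightarrow> O' U" for U by (simp add: topology_inverse')
  then have "generates_topology Q (topology O')" by (simp add: generates_topology_def O'_def)
  then show ?thesis by (rule that)
qed

lemma linear_topology_generated: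
  assumes gen: "generates_topology Q \<sigma>" and ne: "Q \<noteq> {}"
    and semi: "\<And>q. q \<in> Q \<Longrightarrow> seminorm_over scaleK q"
  shows "linear_topology scaleK \<sigma>"
proof -
  have ball: "openin \<sigma> {y. q (y - x) < e}" if "q \<in> Q" for q x e
    using generates_topology_ball[OF gen that] seminorm_over_add[OF semi[OF that]] by blast
  have "openin \<sigma> UNIV"
    using gen ne unfolding generates_topology_def by (metis equals0I subset_UNIV zero_less_one)
  then have top: "topspace \<sigma> = UNIV" by (metis openin_subset top.extremum_uniqueI)
  have zero: "q 0 = 0" if "q \<in> Q" for q using seminorm_over_zero[OF semi[OF that]] .
  have "openin (prod_topology \<sigma> \<sigma>) {z. fst z + snd z \<in> U}" if U: "openin \<sigma> U" for U
    unfolding openin_prod_topology_alt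
  proof (intro allI impI)
    fix x y assume "(x, y) \<in> {z. fst z + snd z \<in> U}"
    then obtain q e where q: "q \<in> Q" "e > 0" "{z. q (z - (x + y)) < e} \<subseteq> U"
      using gen U unfolding generates_topology_def by (metis fst_conv mem_Collect_eq snd_conv)
    have "x' + y' \<in> U" if "q (x' - x) < e / 2" "q (y' - y) < e / 2" for x' y'
    proof -
      have "q (x' + y' - (x + y)) \<le> q (x' - x) + q (y' - y)"
        using seminorm_over_add[OF semi[OF q(1)], of "x' - x" "y' - y"] by (simp add: algebra_simps)
      then show ?thesis using that q(3) by auto
    qed
    then have "{x'. q (x' - x) < e / 2} \<times> {y'. q (y' - y) < e / 2} \<subseteq> {z. fst z + snd z \<in> U}"
      by auto
    then show "\<exists>V W. openin \<sigma> V \<and> openin \<sigma> W \<and> x \<in> V \<and> y \<in> W \<and> V \<times> W \<subseteq> {z. fst z + snd z \<in> U}"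
      using q(2) zero[OF q(1)]
      by (intro exI[of _ "{x'. q (x' - x) < e / 2}"] exI[of _ "{y'. q (y' - y) < e / 2}"]
          conjI ball[OF q(1)]) simp_all
  qed
  then have add: "continuous_map (prod_topology \<sigma> \<sigma>) \<sigma> (\<lambda>(x, y). x + y)"
    by (simp add: continuous_map_def top case_prod_unfold)
  have "openin (prod_topology euclidean \<sigma>) {z. scaleK (fst z) (snd z) \<in> U}" if U: "openin \<sigma> U" for U
    unfolding openin_prod_topology_alt
  proof (intro allI impI)
    fix c x assume "(c, x) \<in> {z. scaleK (fst z) (snd z) \<in> U}"
    then obtain q e where q: "q \<in> Q" "e > 0" "{z. q (z - scaleK c x) < e} \<subseteq> U"
      using gen U unfolding generates_topology_def by (metis fst_conv mem_Collect_eq snd_conv)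
    note nn = seminorm_over_nonneg[OF semi[OF q(1)]]
    have cancel: "a * (e / (2 * a)) = e / 2" if "a > 0" for a using that by simp
    define d where "d = min 1 (e / (2 * (q x + 1)))"
    define e' where "e' = e / (2 * (norm c + 1))"
    have d: "d > 0" and e': "e' > 0" using q(2) nn[of x] by (auto simp: d_def e'_def add_nonneg_pos)
    have "scaleK c' x' \<in> U" if c': "c' \<in> ball c d" and x': "q (x' - x) < e'" for c' x'
    proof -
      have cc: "norm (c' - c) < d" using c' by (simp add: dist_norm norm_minus_commute)
      have "norm c' \<le> norm c + norm (c' - c)" by (metis add_diff_cancel_left' diff_add_cancel norm_triangle_ineq add.commute)
      then have n1: "norm c' \<le> norm c + 1" using cc by (simp add: d_def)
      have "norm c' * q (x' - x) \<le> (norm c + 1) * q (x' - x)"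
        using n1 nn by (rule mult_right_mono)
      also have "\<dots> < (norm c + 1) * e'"
        using x' by (intro mult_strict_left_mono) (auto simp: add_nonneg_pos)
      also have "\<dots> = e / 2" unfolding e'_def by (rule cancel) (simp add: add_nonneg_pos)
      finally have a: "norm c' * q (x' - x) < e / 2" .
      have "norm (c' - c) \<le> e / (2 * (q x + 1))" using cc by (simp add: d_def)
      then have "norm (c' - c) * q x \<le> (e / (2 * (q x + 1))) * (q x + 1)"
        using nn[of x] q(2) by (intro mult_mono) simp_all
      also have "\<dots> = (q x + 1) * (e / (2 * (q x + 1)))" by (rule mult.commute)
      also have "\<dots> = e / 2" using nn[of x] by (intro cancel) simp
      finally have b: "norm (c' - c) * q x \<le> e / 2" .
      have "scaleK c' x' - scaleK c x = scaleK c' (x' - x) + scaleK (c' - c) x"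
        by (simp add: scale_right_diff_distrib scale_left_diff_distrib)
      then have "q (scaleK c' x' - scaleK c x) \<le> norm c' * q (x' - x) + norm (c' - c) * q x"
        by (metis seminorm_over_add seminorm_over_scale semi q(1))
      then show ?thesis using a b q(3) by auto
    qed
    then have "ball c d \<times> {x'. q (x' - x) < e'} \<subseteq> {z. scaleK (fst z) (snd z) \<in> U}"
      by auto
    then show "\<exists>V W. openin euclidean V \<and> openin \<sigma> W \<and> c \<in> V \<and> x \<in> W \<and>
        V \<times> W \<subseteq> {z. scaleK (fst z) (snd z) \<in> U}"
      using zero[OF q(1)] d e'
      by (intro exI[of _ "ball c d"] exI[of _ "{x'. q (x' - x) < e'}"]
          conjI ball[OF q(1)]) simp_all
  qed
  then have "continuous_map (prod_topology euclidean \<sigma>) \<sigma> (\<lambda>(c, x). scaleK c x)"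
    by (simp add: continuous_map_def top case_prod_unfold)
  then show ?thesis using top add by (simp add: linear_topology_def)
qed

end

section \<open>Convergence in the mixed topology\<close>

text \<open>The system \<open>P\<close> of seminorms is fixed because the analysis of \<open>\<gamma>\<close> selects sequences of
  seminorms from it.\<close>

locale saks_space_seminorms = banach_space_over scaleK
  for scaleK :: "'k::real_normed_field \<Rightarrow> 'a::banach \<Rightarrow> 'a" +
  fixes \<tau> :: "'a topology" and P :: "('a \<Rightarrow> real) set"
  assumes linear_\<tau>: "linear_topology scaleK \<tau>"
    and \<tau>_le_norm: "topology_coarser \<tau> euclidean"
    and semi: "\<And>p. p \<in> P \<Longrightarrow> seminorm_over scaleK p"
    and dir: "directed_seminorms P"
    and gen: "generates_topology P \<tau>"
    and bdd: "\<And>x. bdd_above ((\<lambda>p. p x) ` P)"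
    and norm_SUP: "\<And>x. norm x = (SUP p\<in>P. p x)"
begin

abbreviation \<gamma> :: "'a topology" where "\<gamma> \<equiv> mixed_topology scaleK \<tau>"

lemma mixed_candidate_\<gamma>: "mixed_candidate scaleK \<tau> \<gamma>"
  and \<gamma>_finest: "mixed_candidate scaleK \<tau> \<sigma> \<Longrightarrow> topology_coarser \<sigma> \<gamma>"
proof -
  have "mixed_candidate scaleK \<tau> \<gamma> \<and>
      (\<forall>\<sigma>. mixed_candidate scaleK \<tau> \<sigma> \<longrightarrow> topology_coarser \<sigma> \<gamma>)"
    unfolding mixed_topology_def by (rule theI'[OF ex1_mixed_topology[OF linear_\<tau> \<tau>_le_norm]])
  then show "mixed_candidate scaleK \<tau> \<gamma>"
    and "mixed_candidate scaleK \<tau> \<sigma> \<Longrightarrow> topology_coarser \<sigma> \<gamma>" by blast+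
qed

lemma topspace_\<gamma>: "topspace \<gamma> = UNIV"
  using mixed_candidate_\<gamma> by (simp add: mixed_candidate_def linear_topology_def)

lemma P_ne: "P \<noteq> {}"
  using dir by (simp add: directed_seminorms_def)

lemma P_nonneg: "p \<in> P \<Longrightarrow> 0 \<le> p x"
  using seminorm_over_nonneg[OF semi] .

lemma P_le_norm: "p \<in> P \<Longrightarrow> p x \<le> norm x"
  unfolding norm_SUP using bdd by (intro cSUP_upper)

lemma less_norm_P:
  assumes "a < norm x"
  obtains p where "p \<in> P" "a < p x"
  using assms less_cSUP_iff[OF P_ne bdd] unfolding norm_SUP by blast

lemma seminorm_ball_openin_\<tau>: "p \<in> P \<Longrightarrow> openin \<tau> {y. p (y - x) < e}"
  using generates_topology_ball[OF gen] seminorm_over_add[OF semi] by blast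

lemma \<tau>_le_\<gamma>: "openin \<tau> U \<Longrightarrow> openin \<gamma> U"
  and \<gamma>_le_norm: "openin \<gamma> U \<Longrightarrow> open U"
  using mixed_candidate_\<gamma> unfolding mixed_candidate_def topology_coarser_def by auto

lemma limitin_\<gamma>_of_norm:
  assumes "s \<longlonglongrightarrow> l"
  shows "limitin \<gamma> s l sequentially"
  unfolding limitin_def using topspace_\<gamma> topological_tendstoD[OF assms] \<gamma>_le_norm by blast

lemma limitin_\<tau>_of_\<gamma>: "limitin \<gamma> s l sequentially \<Longrightarrow> limitin \<tau> s l sequentially"
  using \<tau>_le_\<gamma> linear_\<tau> unfolding limitin_def linear_topology_def by blast

lemma limitin_\<gamma>_of_\<tau>:
  assumes "limitin \<tau> s l sequentially" "bounded (range s)"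
  shows "limitin \<gamma> s l sequentially"
proof -
  let ?B = "insert l (range s)"
  have "subtopology \<gamma> ?B = subtopology \<tau> ?B"
    using mixed_candidate_\<gamma> assms(2) by (simp add: mixed_candidate_def)
  moreover have "limitin (subtopology \<tau> ?B) s l sequentially"
    using assms(1) by (simp add: limitin_subtopology)
  ultimately show ?thesis by (metis limitin_subtopology)
qed

text \<open>This is the universal property of \<open>\<gamma>\<close> in terms of seminorms: adjoining \<open>q\<close> to \<open>P\<close> gives a
  topology that competes in the definition of the mixed topology.\<close>

lemma seminorm_ball_openin_\<gamma>:
  assumes q: "seminorm_over scaleK q" "\<And>x. q x \<le> norm x"
    and cont: "\<And>R e. 0 < e \<Longrightarrow> \<exists>p\<in>P. \<exists>d>0. \<forall>x. norm x \<le> R \<longrightarrow> p x < d \<longrightarrow> q x < e"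
  shows "openin \<gamma> {y. q (y - x) < e}"
proof -
  define Q where "Q = (\<lambda>p x. max (p x) (q x)) ` P"
  have semiQ: "seminorm_over scaleK r" if rQ: "r \<in> Q" for r
  proof -
    obtain p where p: "p \<in> P" and r: "r = (\<lambda>x. max (p x) (q x))" using rQ by (auto simp: Q_def)
    show ?thesis
      unfolding r seminorm_over_def
    proof (intro conjI allI)
      show "max (p (x + y)) (q (x + y)) \<le> max (p x) (q x) + max (p y) (q y)" for x y
        using seminorm_over_add[OF semi[OF p], of x y] seminorm_over_add[OF q(1), of x y] by linarith
      show "max (p (scaleK c x)) (q (scaleK c x)) = norm c * max (p x) (q x)" for c x
        by (simp add: seminorm_over_scale[OF semi[OF p]] seminorm_over_scale[OF q(1)] max_mult_distrib_left)
    qed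
  qed
  have dirQ: "directed_seminorms Q"
    unfolding directed_seminorms_def
  proof (intro conjI ballI)
    show "Q \<noteq> {}" using P_ne by (simp add: Q_def)
    fix r s assume "r \<in> Q" "s \<in> Q"
    then obtain p p' where p: "p \<in> P" "p' \<in> P" and r: "r = (\<lambda>x. max (p x) (q x))"
      and s: "s = (\<lambda>x. max (p' x) (q x))" by (auto simp: Q_def)
    obtain t C where t: "t \<in> P" "C \<ge> 0" "\<And>x. max (p x) (p' x) \<le> C * t x"
      using dir p unfolding directed_seminorms_def by meson
    have "max (r x) (s x) \<le> (C + 1) * max (t x) (q x)" for x
    proof -
      have "C * t x \<le> (C + 1) * max (t x) (q x)"
        using t(2) P_nonneg[OF t(1), of x] by (intro mult_mono) auto
      moreover have "q x \<le> (C + 1) * max (t x) (q x)"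
        using t(2) seminorm_over_nonneg[OF q(1), of x] mult_mono[of 1 "C + 1" "q x" "max (t x) (q x)"]
        by simp
      ultimately show ?thesis using t(3)[of x] by (simp add: r s)
    qed
    then show "\<exists>r'\<in>Q. \<exists>C\<ge>0. \<forall>x. max (r x) (s x) \<le> C * r' x"
      using t(1,2) unfolding Q_def by (intro bexI[of _ "\<lambda>x. max (t x) (q x)"] exI[of _ "C + 1"]) auto
  qed
  obtain \<sigma> where \<sigma>: "generates_topology Q \<sigma>"
    using generates_topology_exists[OF dirQ semiQ] by blast
  have lin: "linear_topology scaleK \<sigma>"
    using linear_topology_generated[OF \<sigma>] dirQ semiQ by (auto simp: directed_seminorms_def)
  have openin_\<sigma>: "openin \<sigma> U \<longleftrightarrow> (\<forall>x\<in>U. \<exists>p\<in>P. \<exists>e>0. {y. max (p (y - x)) (q (y - x)) < e} \<subseteq> U)" for U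
    using \<sigma> unfolding generates_topology_def Q_def by simp
  have \<tau>\<sigma>: "topology_coarser \<tau> \<sigma>"
    unfolding topology_coarser_def
  proof (intro allI impI)
    fix U assume "openin \<tau> U"
    then have "\<forall>x\<in>U. \<exists>p\<in>P. \<exists>e>0. {y. p (y - x) < e} \<subseteq> U" using gen by (simp add: generates_topology_def)
    moreover have "{y. max (p (y - x)) (q (y - x)) < e} \<subseteq> {y. p (y - x) < e}" for p e x by auto
    ultimately show "openin \<sigma> U" unfolding openin_\<sigma> by (meson order_trans)
  qed
  have "topology_coarser \<sigma> euclidean"
    unfolding topology_coarser_def
  proof (intro allI impI)
    fix U assume U: "openin \<sigma> U"
    have "\<exists>e>0. ball x e \<subseteq> U" if x: "x \<in> U" for x
    proof -
      obtain p e where p: "p \<in> P" "e > 0" "{y. max (p (y - x)) (q (y - x)) < e} \<subseteq> U"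
        using U x unfolding openin_\<sigma> by blast
      have "max (p (y - x)) (q (y - x)) < e" if "y \<in> ball x e" for y
        using that P_le_norm[OF p(1), of "y - x"] q(2)[of "y - x"]
        by (simp add: dist_norm norm_minus_commute)
      then have "ball x e \<subseteq> U" using p(3) by blast
      then show ?thesis using p(2) by blast
    qed
    then show "openin euclidean U" by (simp add: open_contains_ball)
  qed
  moreover have "subtopology \<sigma> B = subtopology \<tau> B" if B: "bounded B" for B
  proof -
    obtain R where R: "\<And>x. x \<in> B \<Longrightarrow> norm x \<le> R" using B by (auto simp: bounded_iff)
    have "\<exists>W. openin \<tau> W \<and> U \<inter> B = W \<inter> B" if U: "openin \<sigma> U" for U
    proof -
      have "\<exists>V. openin \<tau> V \<and> x \<in> V \<and> V \<inter> B \<subseteq> U" if x: "x \<in> U \<inter> B" for x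
      proof -
        obtain p e where p: "p \<in> P" "e > 0" "{y. max (p (y - x)) (q (y - x)) < e} \<subseteq> U"
          using U x unfolding openin_\<sigma> by blast
        obtain p' d where p': "p' \<in> P" "d > 0" "\<And>x. norm x \<le> R + R \<Longrightarrow> p' x < d \<Longrightarrow> q x < e"
          using cont[OF p(2), of "R + R"] by blast
        let ?V = "{y. p (y - x) < e} \<inter> {y. p' (y - x) < d}"
        have "openin \<tau> ?V" using p(1) p'(1) by (intro openin_Int seminorm_ball_openin_\<tau>)
        moreover have "x \<in> ?V"
          using p(1,2) p'(1,2) by (simp add: seminorm_over_zero[OF semi])
        moreover have "?V \<inter> B \<subseteq> U"
        proof
          fix y assume y: "y \<in> ?V \<inter> B"
          have "norm (y - x) \<le> R + R"
            using norm_triangle_ineq4[of y x] R[of x] R[of y] x y by simp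
          then have "q (y - x) < e" using p'(3) y by simp
          then show "y \<in> U" using p(3) y by auto
        qed
        ultimately show ?thesis by blast
      qed
      then obtain V where V: "\<And>x. x \<in> U \<inter> B \<Longrightarrow> openin \<tau> (V x) \<and> x \<in> V x \<and> V x \<inter> B \<subseteq> U"
        by metis
      then have "openin \<tau> (\<Union>x\<in>U \<inter> B. V x)" by (intro openin_Union) auto
      moreover have "U \<inter> B = (\<Union>x\<in>U \<inter> B. V x) \<inter> B" using V by blast
      ultimately show ?thesis by blast
    qed
    then show ?thesis
      using \<tau>\<sigma> unfolding topology_eq openin_subtopology topology_coarser_def by metis
  qed
  ultimately have "mixed_candidate scaleK \<tau> \<sigma>"
    using lin \<tau>\<sigma> by (simp add: mixed_candidate_def)
  then have \<sigma>\<gamma>: "topology_coarser \<sigma> \<gamma>" by (rule \<gamma>_finest)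
  have "openin \<sigma> {y. q (y - x) < e}"
    unfolding openin_\<sigma>
  proof
    fix y assume y: "y \<in> {y. q (y - x) < e}"
    obtain p where p: "p \<in> P" using P_ne by blast
    have "q (z - x) < e" if "q (z - y) < e - q (y - x)" for z
      using seminorm_over_add[OF q(1), of "z - y" "y - x"] that by simp
    then have "{z. max (p (z - y)) (q (z - y)) < e - q (y - x)} \<subseteq> {y. q (y - x) < e}" by auto
    then show "\<exists>p\<in>P. \<exists>d>0. {z. max (p (z - y)) (q (z - y)) < d} \<subseteq> {y. q (y - x) < e}"
      using p y by (intro bexI[of _ p] exI[of _ "e - q (y - x)"]) auto
  qed
  then show ?thesis using \<sigma>\<gamma> by (simp add: topology_coarser_def)
qed

text \<open>Weights tending to zero make a supremum of seminorms from \<open>P\<close> continuous on norm bounded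
  sets, since there only finitely many of them matter.  It is therefore \<open>\<gamma>\<close>-continuous, although
  in general it is not \<open>\<tau>\<close>-continuous.\<close>

lemma weighted_sup_ball_openin_\<gamma>:
  assumes p: "\<And>k. p k \<in> P"
  shows "openin \<gamma> {y. (SUP k. p k (y - x) / (real k + 1)) < e}"
proof -
  define q where "q x = (SUP k. p k x / (real k + 1))" for x
  have term_le: "p k x / (real k + 1) \<le> norm x" for k x
  proof -
    have "p k x / (real k + 1) \<le> p k x" using P_nonneg[OF p, of k x] by (simp add: field_simps)
    then show ?thesis using P_le_norm[OF p, of k x] by linarith
  qed
  have bd: "bdd_above (range (\<lambda>k. p k x / (real k + 1)))" for x
    using term_le by (intro bdd_aboveI2)
  have q_ge: "p k x / (real k + 1) \<le> q x" for k x
    unfolding q_def using bd by (intro cSUP_upper) auto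
  have q_le: "q x \<le> m" if "\<And>k. p k x / (real k + 1) \<le> m" for m x
    unfolding q_def using that by (intro cSUP_least) auto
  have q_nonneg: "0 \<le> q x" for x
    using q_ge[of 0 x] P_nonneg[OF p, of 0 x] by simp
  have add: "q (x + y) \<le> q x + q y" for x y
  proof (rule q_le)
    fix k
    have "p k (x + y) / (real k + 1) \<le> p k x / (real k + 1) + p k y / (real k + 1)"
      using divide_right_mono[OF seminorm_over_add[OF semi[OF p], of k x y], of "real k + 1"]
      by (simp add: add_divide_distrib)
    then show "p k (x + y) / (real k + 1) \<le> q x + q y" using q_ge[of k x] q_ge[of k y] by linarith
  qed
  have half: "q (scaleK c x) \<le> norm c * q x" for c x
  proof (rule q_le)
    fix k
    show "p k (scaleK c x) / (real k + 1) \<le> norm c * q x"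
      using mult_left_mono[OF q_ge[of k x], of "norm c"] by (simp add: seminorm_over_scale[OF semi[OF p]])
  qed
  have "q (scaleK c x) = norm c * q x" for c x
  proof (cases "c = 0")
    case True
    then show ?thesis using half[of c x] q_nonneg[of "scaleK c x"] by simp
  next
    case False
    then have "q x \<le> norm (1 / c) * q (scaleK c x)" using half[of "1 / c" "scaleK c x"] by simp
    then have "norm c * q x \<le> q (scaleK c x)" using False by (simp add: norm_divide field_simps)
    then show ?thesis using half[of c x] by simp
  qed
  then have "seminorm_over scaleK q" by (simp add: seminorm_over_def add)
  moreover have "q x \<le> norm x" for x using term_le by (rule q_le)
  moreover have "\<exists>r\<in>P. \<exists>d>0. \<forall>x. norm x \<le> R \<longrightarrow> r x < d \<longrightarrow> q x < e" if e: "0 < e" for R e :: real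
  proof -
    obtain K :: nat where K: "2 * \<bar>R\<bar> / e < real K" using reals_Archimedean2 by blast
    obtain r C where r: "r \<in> P" "0 < C" "\<And>f x. f \<in> p ` {..<K} \<Longrightarrow> f x \<le> C * r x"
      using directed_seminorms_bound[OF dir, of "p ` {..<K}"] p P_nonneg by (metis finite_imageI finite_lessThan image_subsetI)
    have "q x < e" if x: "norm x \<le> R" "r x < e / (2 * C)" for x
    proof -
      have "p k x / (real k + 1) \<le> e / 2" for k
      proof (cases "k < K")
        case True
        then have "p k x \<le> C * r x" using r(3) by blast
        then have "p k x \<le> e / 2" using x(2) r(2) by (simp add: field_simps)
        moreover have "p k x / (real k + 1) \<le> p k x" using P_nonneg[OF p, of k x] by (simp add: field_simps)
        ultimately show ?thesis by linarith
      next
        case False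
        have "2 * \<bar>R\<bar> < e * real K" using K e by (simp add: field_simps)
        also have "\<dots> \<le> e * (real k + 1)" using False e by simp
        finally have "2 * p k x \<le> e * (real k + 1)" using P_le_norm[OF p, of k x] x(1) by linarith
        then show ?thesis by (simp add: field_simps)
      qed
      then have "q x \<le> e / 2" by (rule q_le)
      then show ?thesis using e by linarith
    qed
    moreover have "0 < e / (2 * C)" using e r(2) by simp
    ultimately show ?thesis using r(1) by blast
  qed
  ultimately have "openin \<gamma> {y. q (y - x) < e}" by (rule seminorm_ball_openin_\<gamma>)
  then show ?thesis by (simp add: q_def)
qed

text \<open>If the norms were unbounded, there would be seminorms \<open>p k\<close> and indices \<open>n k \<ge> k\<close> with
  \<open>p k (s (n k) - l) > (k + 1)\<^sup>2\<close>.  With the weights \<open>1 / (k + 1)\<close> these give a \<open>\<gamma>\<close>-continuous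
  seminorm that exceeds \<open>k + 1\<close> at \<open>s (n k) - l\<close>, which contradicts the convergence.\<close>

lemma bounded_if_limitin_\<gamma>:
  assumes lim: "limitin \<gamma> s l sequentially"
  shows "bounded (range s)"
proof (rule ccontr)
  assume unb: "\<not> bounded (range s)"
  have "\<exists>n\<ge>k. \<exists>p\<in>P. (real k + 1)\<^sup>2 < p (s n - l)" for k :: nat
  proof (rule ccontr)
    assume *: "\<not> ?thesis"
    have "norm (s n) \<le> (real k + 1)\<^sup>2 + norm l" if "n \<ge> k" for n
    proof -
      have "norm (s n - l) \<le> (real k + 1)\<^sup>2"
      proof (rule ccontr)
        assume "\<not> ?thesis"
        then obtain p where "p \<in> P" "(real k + 1)\<^sup>2 < p (s n - l)"
          using less_norm_P[of "(real k + 1)\<^sup>2" "s n - l"] by auto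
        then show False using * that by blast
      qed
      then show ?thesis using norm_triangle_sub[of "s n" l] by linarith
    qed
    then have "bounded (s ` {k..})"
      by (intro boundedI[of _ "(real k + 1)\<^sup>2 + norm l"]) auto
    moreover have "bounded (s ` {..<k})" by (intro finite_imp_bounded finite_imageI) simp
    moreover have "{..<k} \<union> {k..} = (UNIV :: nat set)" by auto
    then have "range s = s ` {..<k} \<union> s ` {k..}" by (metis image_Un)
    ultimately show False using unb by simp
  qed
  then have "\<forall>k. \<exists>n p. n \<ge> k \<and> p \<in> P \<and> (real k + 1)\<^sup>2 < p (s n - l)" by blast
  then obtain n p where np: "\<And>k. n k \<ge> k" "\<And>k. p k \<in> P"
    "\<And>k. (real k + 1)\<^sup>2 < p k (s (n k) - l)"
    by metis
  let ?q = "\<lambda>x. SUP k. p k x / (real k + 1)"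
  have bd: "bdd_above (range (\<lambda>k. p k x / (real k + 1)))" for x
  proof (rule bdd_aboveI2)
    fix k
    have "p k x / (real k + 1) \<le> p k x" using P_nonneg[OF np(2), of k x] by (simp add: field_simps)
    then show "p k x / (real k + 1) \<le> norm x" using P_le_norm[OF np(2), of k x] by linarith
  qed
  have "openin \<gamma> {y. ?q (y - l) < 1}" using np(2) by (rule weighted_sup_ball_openin_\<gamma>)
  moreover have "?q (l - l) < 1" by (simp add: seminorm_over_zero[OF semi[OF np(2)]])
  ultimately have "eventually (\<lambda>m. ?q (s m - l) < 1) sequentially"
    using lim by (auto simp: limitin_def)
  then obtain N where N: "\<And>m. m \<ge> N \<Longrightarrow> ?q (s m - l) < 1" by (auto simp: eventually_sequentially)
  have "real N + 1 \<le> p N (s (n N) - l) / (real N + 1)"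
    using np(3)[of N] by (simp add: field_simps power2_eq_square)
  also have "\<dots> \<le> ?q (s (n N) - l)" using bd by (intro cSUP_upper) auto
  also have "\<dots> < 1" using N np(1) by blast
  finally show False by simp
qed

end

section \<open>The duality between the space and its circ dual\<close>

context saks_space_seminorms
begin

text \<open>The definition of \<open>X\<^sup>\<circ>\<close> covers only bounded sets, but a \<open>\<gamma>\<close>-convergent sequence lies in one.\<close>

lemma circ_dual_tendsto:
  assumes f: "f \<in> circ_dual scaleK \<tau>" and s: "limitin \<gamma> s l sequentially"
  shows "(\<lambda>n. blinfun_apply f (s n)) \<longlonglongrightarrow> blinfun_apply f l"
proof -
  have "bounded (insert l (range s))" using bounded_if_limitin_\<gamma>[OF s] by simp
  moreover have "limitin \<tau> s l sequentially" using s by (rule limitin_\<tau>_of_\<gamma>)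
  ultimately show ?thesis using f unfolding circ_dual_def by blast
qed

lemma norm_dual_linear:
  assumes "f \<in> norm_dual scaleK"
  shows "blinfun_apply f (scaleK c x) = c * blinfun_apply f x"
  using assms by (simp add: norm_dual_def linear_over_iff)

lemma zero_in_circ_dual: "0 \<in> circ_dual scaleK \<tau>"
  unfolding circ_dual_def norm_dual_def mem_Collect_eq linear_over_iff by simp

lemma scaleR_in_circ_dual:
  assumes f: "f \<in> circ_dual scaleK \<tau>"
  shows "r *\<^sub>R f \<in> circ_dual scaleK \<tau>"
proof -
  have nd: "f \<in> norm_dual scaleK" using f by (simp add: circ_dual_def)
  have "r *\<^sub>R f \<in> norm_dual scaleK"
    unfolding norm_dual_def mem_Collect_eq linear_over_iff
    by (simp add: blinfun.scaleR_left blinfun.add_right scaleR_add_right norm_dual_linear[OF nd])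
  moreover have "(\<lambda>n. blinfun_apply (r *\<^sub>R f) (s n)) \<longlonglongrightarrow> blinfun_apply (r *\<^sub>R f) l"
    if "(\<lambda>n. blinfun_apply f (s n)) \<longlonglongrightarrow> blinfun_apply f l" for s l
    unfolding blinfun.scaleR_left using that by (intro tendsto_scaleR tendsto_const)
  ultimately show ?thesis using f unfolding circ_dual_def by blast
qed

text \<open>Functionals dominated by a single seminorm of the system are \<open>\<tau>\<close>-continuous, and the norm
  is the supremum of these seminorms.  This is why the functionals in \<open>X\<^sup>\<circ>\<close> recover the norm.\<close>

lemma circ_dual_norming:
  assumes roc: "real_or_complex TYPE('k)" and a: "a < norm x"
  obtains f where "f \<in> circ_dual scaleK \<tau>" "norm f \<le> 1" "a < norm (blinfun_apply f x)"
proof -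
  obtain p where p: "p \<in> P" "a < p x" using less_norm_P[OF a] by blast
  obtain g where g: "Vector_Spaces.linear scaleK (*) g" "\<And>y. norm (g y) \<le> p y" "norm (g x) = p x"
    using dominated_functional[OF roc semi[OF p(1)], of x] by blast
  have g_add: "g (y + z) = g y + g z" and g_scale: "g (scaleK c y) = c * g y" for y z c
    using g(1) by (auto simp: linear_over_iff)
  have g_le: "norm (g y) \<le> norm y" for y using g(2)[of y] P_le_norm[OF p(1), of y] by linarith
  have "bounded_linear g"
  proof (rule bounded_linear_intro[of _ 1])
    show "g (r *\<^sub>R y) = r *\<^sub>R g y" for r y
      using g_scale[of "of_real r" y] by (simp add: scale_of_real scaleR_conv_of_real)
  qed (use g_add g_le in auto)
  then have app: "blinfun_apply (Blinfun g) = g" by (rule bounded_linear_Blinfun_apply)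
  have g_diff: "g (y - z) = g y - g z" for y z
    using g_add[of "y - z" z] by simp
  have "(\<lambda>n. g (s n)) \<longlonglongrightarrow> g l" if lim: "limitin \<tau> s l sequentially" for s l
  proof (rule metric_LIMSEQ_I)
    fix e :: real assume e: "e > 0"
    have "openin \<tau> {y. p (y - l) < e}" using p(1) by (rule seminorm_ball_openin_\<tau>)
    moreover have "l \<in> {y. p (y - l) < e}" using e by (simp add: seminorm_over_zero[OF semi[OF p(1)]])
    ultimately have "eventually (\<lambda>n. s n \<in> {y. p (y - l) < e}) sequentially"
      using limitinD[OF lim] by blast
    then obtain N where "\<And>n. n \<ge> N \<Longrightarrow> p (s n - l) < e" by (auto simp: eventually_sequentially)
    then have "dist (g (s n)) (g l) < e" if "n \<ge> N" for n
      using that g(2)[of "s n - l"] by (auto simp: dist_norm g_diff intro: le_less_trans)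
    then show "\<exists>N. \<forall>n\<ge>N. dist (g (s n)) (g l) < e" by blast
  qed
  then have "Blinfun g \<in> circ_dual scaleK \<tau>"
    using g(1) by (simp add: circ_dual_def norm_dual_def app)
  moreover have "norm (Blinfun g) \<le> 1"
    using g_le by (intro norm_blinfun_bound) (simp_all add: app)
  moreover have "a < norm (blinfun_apply (Blinfun g) x)" using p(2) g(3) by (simp add: app)
  ultimately show ?thesis by (rule that)
qed

end

section \<open>Orbit means and the bi-sun dual\<close>

locale mazur_bicontinuous_semigroup = saks_space_seminorms scaleK \<tau> P
  for scaleK :: "'k::{real_normed_field,banach} \<Rightarrow> 'a::banach \<Rightarrow> 'a" and \<tau> P +
  fixes T :: "real \<Rightarrow> 'a \<Rightarrow>\<^sub>L 'a"
  assumes mazur: "mazur_saks_space scaleK \<tau>"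
    and bicontinuous: "bicontinuous_semigroup scaleK \<tau> T"
begin

lemma T_scale: "0 \<le> t \<Longrightarrow> blinfun_apply (T t) (scaleK c x) = scaleK c (blinfun_apply (T t) x)"
  using bicontinuous by (auto simp: bicontinuous_semigroup_def Vector_Spaces.linear_iff)

lemma T_0: "T 0 = id_blinfun"
  using bicontinuous by (simp add: bicontinuous_semigroup_def)

lemma T_add: "0 \<le> t \<Longrightarrow> 0 \<le> s \<Longrightarrow> T (t + s) = T t o\<^sub>L T s"
  using bicontinuous by (simp add: bicontinuous_semigroup_def)

lemma T_locally_uniform:
  assumes "limitin \<gamma> s x sequentially" "0 \<le> b" "openin \<gamma> U" "0 \<in> U"
  obtains N where "\<And>n t. n \<ge> N \<Longrightarrow> t \<in> {0..b} \<Longrightarrow> blinfun_apply (T t) (s n - x) \<in> U"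
  using assms bicontinuous unfolding bicontinuous_semigroup_def by meson

text \<open>If \<open>T\<close> were unbounded on \<open>[0, b]\<close>, there would be a norm null sequence \<open>y\<close> and times \<open>t\<close>
  with \<open>T (t n) (y n)\<close> unbounded.  Bi-continuity makes the latter sequence a \<open>\<gamma>\<close>-null sequence,
  and these are bounded.\<close>

lemma T_locally_bounded:
  assumes b: "0 \<le> b"
  obtains M where "1 \<le> M" "\<And>t. t \<in> {0..b} \<Longrightarrow> norm (T t) \<le> M"
proof (rule ccontr)
  assume unb: "\<not> thesis"
  have "\<exists>t\<in>{0..b}. \<exists>y. norm y = 1 / (real n + 1) \<and> real n + 1 < norm (blinfun_apply (T t) y)" for n :: nat
  proof -
    have "\<exists>t\<in>{0..b}. (real n + 1)\<^sup>2 < norm (T t)"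
    proof (rule ccontr)
      assume "\<not> ?thesis"
      then have "\<And>t. t \<in> {0..b} \<Longrightarrow> norm (T t) \<le> (real n + 1)\<^sup>2"
        by (auto simp: not_less)
      moreover have "1 \<le> (real n + 1)\<^sup>2" by (rule one_le_power) simp
      ultimately show False using unb that[of "(real n + 1)\<^sup>2"] by blast
    qed
    then obtain t where t: "t \<in> {0..b}" "(real n + 1)\<^sup>2 < norm (T t)" by blast
    have "\<exists>x. (real n + 1)\<^sup>2 * norm x < norm (blinfun_apply (T t) x)"
    proof (rule ccontr)
      assume "\<not> ?thesis"
      then have "norm (T t) \<le> (real n + 1)\<^sup>2"
        by (intro norm_blinfun_bound) (auto simp: not_less)
      then show False using t(2) by simp
    qed
    then obtain x where x: "(real n + 1)\<^sup>2 * norm x < norm (blinfun_apply (T t) x)" by blast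
    then have x0: "0 < norm x" by (cases "x = 0") auto
    define c where "c = 1 / ((real n + 1) * norm x)"
    have c: "c > 0" using x0 by (simp add: c_def)
    have cx: "c * norm x = 1 / (real n + 1)" using x0 by (simp add: c_def)
    have "real n + 1 = (real n + 1)\<^sup>2 * (c * norm x)" by (simp add: cx power2_eq_square)
    also have "\<dots> = c * ((real n + 1)\<^sup>2 * norm x)" by (simp add: ac_simps)
    also have "\<dots> < c * norm (blinfun_apply (T t) x)" using x c by (rule mult_strict_left_mono)
    also have "\<dots> = norm (blinfun_apply (T t) (c *\<^sub>R x))" using c by (simp add: blinfun.scaleR_right)
    finally show ?thesis using t(1) cx c by (intro bexI[of _ t] exI[of _ "c *\<^sub>R x"]) auto
  qed
  then obtain t y where t: "\<And>n. t n \<in> {0..b}" and y: "\<And>n :: nat. norm (y n) = 1 / (real n + 1)"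
    and big: "\<And>n. real n + 1 < norm (blinfun_apply (T (t n)) (y n))"
    by metis
  have "(\<lambda>n. norm (y n)) \<longlonglongrightarrow> 0"
    using LIMSEQ_inverse_real_of_nat by (simp add: y inverse_eq_divide add.commute)
  then have "y \<longlonglongrightarrow> 0" by (rule tendsto_norm_zero_cancel)
  then have lim: "limitin \<gamma> y 0 sequentially" by (rule limitin_\<gamma>_of_norm)
  have "\<exists>N. \<forall>n\<ge>N. blinfun_apply (T (t n)) (y n) \<in> U" if U: "openin \<gamma> U" "0 \<in> U" for U
  proof -
    obtain N where "\<And>n r. n \<ge> N \<Longrightarrow> r \<in> {0..b} \<Longrightarrow> blinfun_apply (T r) (y n - 0) \<in> U"
      using T_locally_uniform[OF lim b U] by blast
    then have "\<forall>n\<ge>N. blinfun_apply (T (t n)) (y n) \<in> U" using t by simp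
    then show ?thesis by blast
  qed
  then have "limitin \<gamma> (\<lambda>n. blinfun_apply (T (t n)) (y n)) 0 sequentially"
    unfolding limitin_sequentially by (simp add: topspace_\<gamma>)
  then have "bounded (range (\<lambda>n. blinfun_apply (T (t n)) (y n)))" by (rule bounded_if_limitin_\<gamma>)
  then obtain K where K: "\<And>n. norm (blinfun_apply (T (t n)) (y n)) \<le> K" by (auto simp: bounded_iff)
  obtain n :: nat where "K < real n" using reals_Archimedean2 by blast
  then show False using K[of n] big[of n] by simp
qed

lemma circ_dual_continuous_map:
  assumes f: "f \<in> circ_dual scaleK \<tau>"
  shows "continuous_map \<gamma> euclidean (blinfun_apply f)"
proof -
  have "Vector_Spaces.linear scaleK (*) (blinfun_apply f)"
    using f by (simp add: circ_dual_def norm_dual_def)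
  then show ?thesis using mazur circ_dual_tendsto[OF f] unfolding mazur_saks_space_def by blast
qed

lemma orbit_continuous:
  assumes f: "f \<in> circ_dual scaleK \<tau>" and S: "S \<subseteq> {0..}"
  shows "continuous_on S (\<lambda>t. blinfun_apply f (blinfun_apply (T t) x))"
proof -
  have "continuous_map (top_of_set {0..}) \<gamma> (\<lambda>t. blinfun_apply (T t) x)"
    using bicontinuous by (simp add: bicontinuous_semigroup_def)
  from continuous_map_compose[OF this circ_dual_continuous_map[OF f]]
  have "continuous_on {0..} (\<lambda>t. blinfun_apply f (blinfun_apply (T t) x))"
    by (simp add: o_def)
  then show ?thesis using S by (rule continuous_on_subset)
qed

lemma orbit_integrable:
  assumes f: "f \<in> circ_dual scaleK \<tau>" and "0 \<le> a"
  shows "(\<lambda>s. blinfun_apply f (blinfun_apply (T s) x)) integrable_on {a..b}"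
  by (rule integrable_continuous_real, rule orbit_continuous[OF f]) (use assms(2) in auto)

lemma orbit_integral_bound:
  assumes f: "f \<in> circ_dual scaleK \<tau>" and ab: "0 \<le> a" "a \<le> b"
    and K: "\<And>s. s \<in> {a..b} \<Longrightarrow> norm (blinfun_apply f (blinfun_apply (T s) x)) \<le> K"
  shows "norm (integral {a..b} (\<lambda>s. blinfun_apply f (blinfun_apply (T s) x))) \<le> K * (b - a)"
  using ab(2) orbit_continuous[OF f] K by (rule integral_bound) (use ab in auto)

lemma norm_orbit_le:
  assumes "norm (T s) \<le> M"
  shows "norm (blinfun_apply f (blinfun_apply (T s) x)) \<le> norm f * M * norm x"
proof -
  have "norm (blinfun_apply (T s) x) \<le> M * norm x"
    using norm_blinfun[of "T s" x] mult_right_mono[OF assms norm_ge_zero[of x]] by linarith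
  then have "norm f * norm (blinfun_apply (T s) x) \<le> norm f * (M * norm x)"
    by (rule mult_left_mono) simp
  then show ?thesis using norm_blinfun[of f "blinfun_apply (T s) x"] by (simp add: ac_simps)
qed

text \<open>This is the mean over \<open>[0, t]\<close> of the orbit of \<open>f\<close> under the dual semigroup.  The integral is
  taken pointwise, since the orbit need not be norm continuous.\<close>

definition orbit_mean :: "('a \<Rightarrow>\<^sub>L 'k) \<Rightarrow> real \<Rightarrow> 'a \<Rightarrow>\<^sub>L 'k" where
  "orbit_mean f t =
     Blinfun (\<lambda>x. (1 / t) *\<^sub>R integral {0..t} (\<lambda>s. blinfun_apply f (blinfun_apply (T s) x)))"

context
  fixes f :: "'a \<Rightarrow>\<^sub>L 'k" and t :: real
  assumes f: "f \<in> circ_dual scaleK \<tau>" and t: "0 < t"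
begin

lemma orbit_mean_pointwise_bound:
  assumes "\<And>s. s \<in> {0..t} \<Longrightarrow> norm (blinfun_apply f (blinfun_apply (T s) x)) \<le> K"
  shows "norm ((1 / t) *\<^sub>R integral {0..t} (\<lambda>s. blinfun_apply f (blinfun_apply (T s) x))) \<le> K"
  using orbit_integral_bound[OF f, of 0 t x K] assms t by (simp add: field_simps)

lemma bounded_linear_orbit_mean:
  "bounded_linear (\<lambda>x. (1 / t) *\<^sub>R integral {0..t} (\<lambda>s. blinfun_apply f (blinfun_apply (T s) x)))"
proof -
  obtain M where M: "1 \<le> M" "\<And>s. s \<in> {0..t} \<Longrightarrow> norm (T s) \<le> M"
    using T_locally_bounded[of t] t by auto
  show ?thesis
  proof (rule bounded_linear_intro[of _ "norm f * M"])
    fix x y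
    show "(1 / t) *\<^sub>R integral {0..t} (\<lambda>s. blinfun_apply f (blinfun_apply (T s) (x + y))) =
      (1 / t) *\<^sub>R integral {0..t} (\<lambda>s. blinfun_apply f (blinfun_apply (T s) x)) +
      (1 / t) *\<^sub>R integral {0..t} (\<lambda>s. blinfun_apply f (blinfun_apply (T s) y))"
      by (simp add: blinfun.add_right integral_add orbit_integrable[OF f] scaleR_add_right)
  next
    fix r x
    show "(1 / t) *\<^sub>R integral {0..t} (\<lambda>s. blinfun_apply f (blinfun_apply (T s) (r *\<^sub>R x))) =
      r *\<^sub>R (1 / t) *\<^sub>R integral {0..t} (\<lambda>s. blinfun_apply f (blinfun_apply (T s) x))"
      by (simp add: blinfun.scaleR_right)
  next
    fix x
    show "norm ((1 / t) *\<^sub>R integral {0..t} (\<lambda>s. blinfun_apply f (blinfun_apply (T s) x)))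
        \<le> norm x * (norm f * M)"
      using norm_orbit_le[OF M(2), of _ f x] by (intro orbit_mean_pointwise_bound) (simp add: ac_simps)
  qed
qed

lemma orbit_mean_apply:
  "blinfun_apply (orbit_mean f t) x =
     (1 / t) *\<^sub>R integral {0..t} (\<lambda>s. blinfun_apply f (blinfun_apply (T s) x))"
  unfolding orbit_mean_def bounded_linear_Blinfun_apply[OF bounded_linear_orbit_mean] ..

lemma norm_orbit_mean_apply_le:
  assumes "\<And>s. s \<in> {0..t} \<Longrightarrow> norm (blinfun_apply f (blinfun_apply (T s) x)) \<le> K"
  shows "norm (blinfun_apply (orbit_mean f t) x) \<le> K"
  using orbit_mean_pointwise_bound[OF assms] by (simp add: orbit_mean_apply)

lemma norm_orbit_mean_le:
  assumes M: "1 \<le> M" "\<And>s. s \<in> {0..t} \<Longrightarrow> norm (T s) \<le> M"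
  shows "norm (orbit_mean f t) \<le> norm f * M"
proof (rule norm_blinfun_bound)
  show "0 \<le> norm f * M" using M(1) by simp
  show "norm (blinfun_apply (orbit_mean f t) x) \<le> norm f * M * norm x" for x
    by (rule norm_orbit_mean_apply_le) (rule norm_orbit_le[OF M(2)])
qed

text \<open>Along a bounded \<open>\<tau>\<close>-convergent sequence the integrands converge uniformly in time, because
  \<open>f\<close> is \<open>\<gamma>\<close>-continuous and the semigroup is bi-continuous.\<close>

lemma orbit_mean_in_circ_dual: "orbit_mean f t \<in> circ_dual scaleK \<tau>"
proof -
  have "blinfun_apply (orbit_mean f t) (scaleK c x) = c * blinfun_apply (orbit_mean f t) x" for c x
  proof -
    have "f \<in> norm_dual scaleK" using f by (simp add: circ_dual_def)
    then have "integral {0..t} (\<lambda>s. blinfun_apply f (blinfun_apply (T s) (scaleK c x))) =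
        integral {0..t} ((\<lambda>z. c * z) \<circ> (\<lambda>s. blinfun_apply f (blinfun_apply (T s) x)))"
      by (intro integral_cong) (simp add: T_scale norm_dual_linear)
    also have "\<dots> = c * integral {0..t} (\<lambda>s. blinfun_apply f (blinfun_apply (T s) x))"
      by (rule integral_linear[OF orbit_integrable[OF f] bounded_linear_mult_right]) simp
    finally show ?thesis by (simp add: orbit_mean_apply)
  qed
  then have "orbit_mean f t \<in> norm_dual scaleK"
    by (simp add: norm_dual_def linear_over_iff blinfun.add_right)
  moreover have "(\<lambda>n. blinfun_apply (orbit_mean f t) (s n)) \<longlonglongrightarrow> blinfun_apply (orbit_mean f t) l"
    if B: "bounded B" "range s \<subseteq> B" and lim: "limitin \<tau> s l sequentially" for B s l
  proof (rule metric_LIMSEQ_I)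
    fix e :: real assume e: "e > 0"
    have lim\<gamma>: "limitin \<gamma> s l sequentially"
      using lim bounded_subset[OF B] by (rule limitin_\<gamma>_of_\<tau>)
    have "openin \<gamma> {y. norm (blinfun_apply f y) < e / 2}"
      using openin_continuous_map_preimage[OF circ_dual_continuous_map[OF f], of "ball 0 (e / 2)"]
      by (simp add: topspace_\<gamma>)
    moreover have "0 \<in> {y. norm (blinfun_apply f y) < e / 2}" using e by simp
    moreover have "0 \<le> t" using t by simp
    ultimately obtain N where N: "\<And>n r. n \<ge> N \<Longrightarrow> r \<in> {0..t} \<Longrightarrow>
        blinfun_apply (T r) (s n - l) \<in> {y. norm (blinfun_apply f y) < e / 2}"
      using T_locally_uniform[OF lim\<gamma>] by metis
    have "dist (blinfun_apply (orbit_mean f t) (s n)) (blinfun_apply (orbit_mean f t) l) < e"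
      if "n \<ge> N" for n
    proof -
      have "norm (blinfun_apply (orbit_mean f t) (s n - l)) \<le> e / 2"
        using N[OF that] by (intro norm_orbit_mean_apply_le) (auto intro: less_imp_le)
      then show ?thesis using e by (simp add: dist_norm blinfun.diff_right)
    qed
    then show "\<exists>N. \<forall>n\<ge>N. dist (blinfun_apply (orbit_mean f t) (s n))
        (blinfun_apply (orbit_mean f t) l) < e" by blast
  qed
  ultimately show ?thesis unfolding circ_dual_def by blast
qed

text \<open>Shifting the interval of integration by \<open>h\<close> changes the integral only by two integrals over
  intervals of length \<open>h\<close>, uniformly on the unit ball of the space, so the mean moves by at most a
  multiple of \<open>h\<close> in the dual norm.\<close>

lemma orbit_mean_in_bisun_dual: "orbit_mean f t \<in> bisun_dual scaleK \<tau> T"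
proof -
  obtain M where M: "1 \<le> M" "\<And>s. s \<in> {0..t + 1} \<Longrightarrow> norm (T s) \<le> M"
    using T_locally_bounded[of "t + 1"] t by auto
  have est: "norm ((orbit_mean f t o\<^sub>L T h) - orbit_mean f t) \<le> (2 * norm f * M / t) * h"
    if h: "0 < h" "h < 1" for h
  proof (rule norm_blinfun_bound)
    show "0 \<le> 2 * norm f * M / t * h" using t M(1) h by simp
    fix x
    define g where "g s = blinfun_apply f (blinfun_apply (T s) x)" for s
    have int: "g integrable_on {a..b}" if "0 \<le> a" for a b
      unfolding g_def by (rule orbit_integrable[OF f that])
    have bound: "norm (integral {a..b} g) \<le> norm f * M * norm x * (b - a)"
      if "0 \<le> a" "a \<le> b" "b \<le> t + 1" for a b
      unfolding g_def using that M(2) by (intro orbit_integral_bound[OF f] norm_orbit_le) auto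
    have "integral {0..t} (\<lambda>s. blinfun_apply f (blinfun_apply (T s) (blinfun_apply (T h) x))) =
        integral {0..t} (\<lambda>s. g (s + h))"
      using h by (intro integral_cong) (simp add: g_def T_add)
    also have "\<dots> = integral {h..t + h} g"
      using integral_shift_real_ivl[of h h "t + h" g] by simp
    finally have "blinfun_apply ((orbit_mean f t o\<^sub>L T h) - orbit_mean f t) x =
        (1 / t) *\<^sub>R (integral {h..t + h} g - integral {0..t} g)"
      by (simp add: blinfun.diff_left orbit_mean_apply scaleR_diff_right flip: g_def)
    also have "integral {h..t + h} g - integral {0..t} g = integral {t..t + h} g - integral {0..h} g"
      using Henstock_Kurzweil_Integration.integral_combine[of 0 t "t + h" g]
        Henstock_Kurzweil_Integration.integral_combine[of 0 h "t + h" g] int[of 0 "t + h"] t h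
      by (simp add: algebra_simps)
    finally have "norm (blinfun_apply ((orbit_mean f t o\<^sub>L T h) - orbit_mean f t) x) =
        (1 / t) * norm (integral {t..t + h} g - integral {0..h} g)"
      using t by simp
    also have "norm (integral {t..t + h} g - integral {0..h} g) \<le>
        norm f * M * norm x * h + norm f * M * norm x * h"
    proof (rule order_trans[OF norm_triangle_ineq4 add_mono])
      show "norm (integral {t..t + h} g) \<le> norm f * M * norm x * h"
        using bound[of t "t + h"] t h by simp
      show "norm (integral {0..h} g) \<le> norm f * M * norm x * h"
        using bound[of 0 h] t h by simp
    qed
    finally show "norm (blinfun_apply ((orbit_mean f t o\<^sub>L T h) - orbit_mean f t) x) \<le>
        2 * norm f * M / t * h * norm x"
      using t by (simp add: field_simps)
  qed
  have "((\<lambda>h. (2 * norm f * M / t) * h) \<longlongrightarrow> (2 * norm f * M / t) * 0) (at_right 0)"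
    by (intro tendsto_intros)
  then have "((\<lambda>h. (2 * norm f * M / t) * h) \<longlongrightarrow> 0) (at_right 0)" by simp
  moreover have "eventually (\<lambda>h. h \<in> {0<..<1}) (at_right (0::real))"
    by (rule eventually_at_right_real) simp
  then have "eventually (\<lambda>h. norm (norm ((orbit_mean f t o\<^sub>L T h) - orbit_mean f t)) \<le>
      (2 * norm f * M / t) * h) (at_right 0)"
    by (rule eventually_mono) (use est in auto)
  ultimately have "((\<lambda>h. norm ((orbit_mean f t o\<^sub>L T h) - orbit_mean f t)) \<longlongrightarrow> 0) (at_right 0)"
    by (rule Lim_null_comparison[rotated])
  then show ?thesis using orbit_mean_in_circ_dual by (simp add: bisun_dual_def)
qed

end

lemma orbit_mean_approx:
  assumes f: "f \<in> circ_dual scaleK \<tau>" and e: "0 < e"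
  obtains t where "0 < t" "t \<le> 1" "norm (blinfun_apply (orbit_mean f t) x - blinfun_apply f x) \<le> e"
proof -
  let ?g = "\<lambda>s. blinfun_apply f (blinfun_apply (T s) x)"
  have "continuous_on {0..} ?g" using f by (rule orbit_continuous) simp
  then obtain d where d: "d > 0" "\<And>s. s \<in> {0..} \<Longrightarrow> dist s 0 < d \<Longrightarrow> dist (?g s) (?g 0) < e"
    using e unfolding continuous_on_iff by (metis atLeast_iff order_refl)
  define t where "t = min 1 (d / 2)"
  have t: "0 < t" "t \<le> 1" "t < d" using d(1) by (auto simp: t_def)
  have "integral {0..t} (\<lambda>s. ?g s - ?g 0) = integral {0..t} ?g - t *\<^sub>R ?g 0"
    using t(1) orbit_integrable[OF f, of 0 x t] by (subst integral_diff) auto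
  then have "blinfun_apply (orbit_mean f t) x - blinfun_apply f x =
      (1 / t) *\<^sub>R integral {0..t} (\<lambda>s. ?g s - ?g 0)"
    using t(1) by (simp add: orbit_mean_apply[OF f] scaleR_diff_right T_0)
  moreover have "norm (integral {0..t} (\<lambda>s. ?g s - ?g 0)) \<le> e * (t - 0)"
  proof (rule integral_bound)
    show "continuous_on {0..t} (\<lambda>s. ?g s - ?g 0)"
      by (intro continuous_on_diff continuous_on_const orbit_continuous[OF f]) auto
    show "norm (?g s - ?g 0) \<le> e" if "s \<in> {0..t}" for s
      using d(2)[of s] that t by (simp add: dist_norm)
  qed (use t in auto)
  ultimately have "norm (blinfun_apply (orbit_mean f t) x - blinfun_apply f x) \<le> e"
    using t(1) by (simp add: field_simps)
  with t(1,2) show ?thesis by (rule that)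
qed

lemma zero_in_bisun_dual: "0 \<in> bisun_dual scaleK \<tau> T"
  using zero_in_circ_dual by (simp add: bisun_dual_def)

lemma scaleR_in_bisun_dual:
  assumes f: "f \<in> bisun_dual scaleK \<tau> T"
  shows "r *\<^sub>R f \<in> bisun_dual scaleK \<tau> T"
proof -
  have "((\<lambda>t. \<bar>r\<bar> * norm ((f o\<^sub>L T t) - f)) \<longlongrightarrow> \<bar>r\<bar> * 0) (at_right 0)"
    using f by (intro tendsto_mult tendsto_const) (simp add: bisun_dual_def)
  moreover have "\<bar>r\<bar> * norm ((f o\<^sub>L T t) - f) = norm ((r *\<^sub>R f o\<^sub>L T t) - r *\<^sub>R f)" for t
  proof -
    have "(r *\<^sub>R f o\<^sub>L T t) - r *\<^sub>R f = r *\<^sub>R ((f o\<^sub>L T t) - f)"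
      by (rule blinfun_eqI) (simp add: blinfun.diff_left blinfun.scaleR_left scaleR_diff_right)
    then show ?thesis by simp
  qed
  ultimately show ?thesis
    using f scaleR_in_circ_dual by (simp add: bisun_dual_def)
qed

lemma bisun_ball_apply_le:
  assumes "f \<in> {f \<in> bisun_dual scaleK \<tau> T. norm f \<le> 1}"
  shows "norm (blinfun_apply f x) \<le> norm x"
  using norm_blinfun[of f x] assms mult_right_mono[of "norm f" 1 "norm x"] by simp

lemma bisun_norm_upper:
  assumes "f \<in> bisun_dual scaleK \<tau> T" "norm f \<le> 1"
  shows "norm (blinfun_apply f x) \<le> bisun_norm scaleK \<tau> T x"
  unfolding bisun_norm_def
  using assms bisun_ball_apply_le by (intro cSUP_upper bdd_aboveI2) auto

lemma bisun_norm_least: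
  assumes "\<And>f. f \<in> bisun_dual scaleK \<tau> T \<Longrightarrow> norm f \<le> 1 \<Longrightarrow> norm (blinfun_apply f x) \<le> m"
  shows "bisun_norm scaleK \<tau> T x \<le> m"
  unfolding bisun_norm_def
  using assms zero_in_bisun_dual by (intro cSUP_least) auto

lemma bisun_norm_le_norm: "bisun_norm scaleK \<tau> T x \<le> norm x"
  using bisun_ball_apply_le by (intro bisun_norm_least) simp

lemma bisun_norm_nonneg: "0 \<le> bisun_norm scaleK \<tau> T x"
  using bisun_norm_upper[OF zero_in_bisun_dual, of x] by simp

lemma seminorm_over_bisun_norm: "seminorm_over scaleK (bisun_norm scaleK \<tau> T)"
  unfolding seminorm_over_def
proof (intro conjI allI)
  let ?N = "bisun_norm scaleK \<tau> T"
  show "?N (x + y) \<le> ?N x + ?N y" for x y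
  proof (rule bisun_norm_least)
    fix f assume f: "f \<in> bisun_dual scaleK \<tau> T" "norm f \<le> 1"
    show "norm (blinfun_apply f (x + y)) \<le> ?N x + ?N y"
      using bisun_norm_upper[OF f, of x] bisun_norm_upper[OF f, of y]
        norm_triangle_ineq[of "blinfun_apply f x" "blinfun_apply f y"]
      by (simp add: blinfun.add_right)
  qed
  have half: "?N (scaleK c x) \<le> norm c * ?N x" for c x
  proof (rule bisun_norm_least)
    fix f assume f: "f \<in> bisun_dual scaleK \<tau> T" "norm f \<le> 1"
    then have "f \<in> norm_dual scaleK" by (simp add: bisun_dual_def circ_dual_def)
    then show "norm (blinfun_apply f (scaleK c x)) \<le> norm c * ?N x"
      using mult_left_mono[OF bisun_norm_upper[OF f, of x], of "norm c"]
      by (simp add: norm_dual_linear norm_mult)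
  qed
  show "?N (scaleK c x) = norm c * ?N x" for c x
  proof (cases "c = 0")
    case True
    then show ?thesis using half[of c x] bisun_norm_nonneg[of "scaleK c x"] by simp
  next
    case False
    then have "?N x \<le> norm (1 / c) * ?N (scaleK c x)" using half[of "1 / c" "scaleK c x"] by simp
    then have "norm c * ?N x \<le> ?N (scaleK c x)" using False by (simp add: norm_divide field_simps)
    then show ?thesis using half[of c x] by simp
  qed
qed

text \<open>The means of a functional in the unit ball of \<open>X\<^sup>\<circ>\<close> lie in the \<open>M\<close>-fold unit ball of the
  bi-sun dual and converge pointwise to that functional.\<close>

lemma circ_dual_le_bisun_norm:
  assumes f: "f \<in> circ_dual scaleK \<tau>" "norm f \<le> 1"
    and M: "1 \<le> M" "\<And>s. s \<in> {0..1} \<Longrightarrow> norm (T s) \<le> M"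
  shows "norm (blinfun_apply f x) \<le> M * bisun_norm scaleK \<tau> T x"
proof (rule field_le_epsilon)
  fix e :: real assume "0 < e"
  then obtain t where t: "0 < t" "t \<le> 1"
    "norm (blinfun_apply (orbit_mean f t) x - blinfun_apply f x) \<le> e"
    using orbit_mean_approx[OF f(1)] by blast
  let ?m = "orbit_mean f t"
  have "norm ?m \<le> norm f * M"
    using t(2) M by (intro norm_orbit_mean_le[OF f(1) t(1)]) auto
  also have "\<dots> \<le> 1 * M" using f(2) M(1) by (intro mult_right_mono) auto
  finally have "norm ((1 / M) *\<^sub>R ?m) \<le> 1" using M(1) by (simp add: field_simps)
  moreover have "(1 / M) *\<^sub>R ?m \<in> bisun_dual scaleK \<tau> T"
    by (intro scaleR_in_bisun_dual orbit_mean_in_bisun_dual f(1) t(1))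
  ultimately have "norm (blinfun_apply ((1 / M) *\<^sub>R ?m) x) \<le> bisun_norm scaleK \<tau> T x"
    by (intro bisun_norm_upper)
  then have "norm (blinfun_apply ?m x) \<le> M * bisun_norm scaleK \<tau> T x"
    using M(1) by (simp add: blinfun.scaleR_left field_simps)
  moreover have "norm (blinfun_apply f x) \<le>
      norm (blinfun_apply ?m x) + norm (blinfun_apply ?m x - blinfun_apply f x)"
    using norm_triangle_sub[of "blinfun_apply f x" "blinfun_apply ?m x"] by (simp add: norm_minus_commute)
  ultimately show "norm (blinfun_apply f x) \<le> M * bisun_norm scaleK \<tau> T x + e"
    using t(3) by linarith
qed

lemma norm_le_bisun_norm:
  assumes roc: "real_or_complex TYPE('k)"
    and M: "1 \<le> M" "\<And>s. s \<in> {0..1} \<Longrightarrow> norm (T s) \<le> M"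
  shows "norm x \<le> M * bisun_norm scaleK \<tau> T x"
proof (rule ccontr)
  assume "\<not> ?thesis"
  then obtain f where f: "f \<in> circ_dual scaleK \<tau>" "norm f \<le> 1"
    "M * bisun_norm scaleK \<tau> T x < norm (blinfun_apply f x)"
    using circ_dual_norming[OF roc, of "M * bisun_norm scaleK \<tau> T x" x] by auto
  then show False using circ_dual_le_bisun_norm[OF f(1,2) M, of x] by simp
qed

end

section \<open>Equivalence of the norms\<close>

theorem theorem4p3:
  fixes scaleK :: "'k::{real_normed_field,banach} \<Rightarrow> 'a::banach \<Rightarrow> 'a"
    and \<tau> :: "'a topology"
    and T :: "real \<Rightarrow> 'a \<Rightarrow>\<^sub>L 'a"
  assumes "real_or_complex TYPE('k)"
    and "banach_space_over scaleK"
    and "sequentially_complete_saks_space scaleK \<tau>"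
    and "d_consistent scaleK \<tau>"
    and "mazur_saks_space scaleK \<tau>"
    and "bicontinuous_semigroup scaleK \<tau> T"
  shows "equivalent_norms scaleK (bisun_norm scaleK \<tau> T) norm"
proof -
  have saks: "saks_space scaleK \<tau>" using assms(5) by (simp add: mazur_saks_space_def)
  then obtain P where P: "\<forall>p\<in>P. seminorm_over scaleK p" "directed_seminorms P"
    "generates_topology P \<tau>" "\<forall>x. bdd_above ((\<lambda>p. p x) ` P) \<and> norm x = (SUP p\<in>P. p x)"
    unfolding saks_space_def by blast
  interpret banach_space_over scaleK by (rule assms(2))
  interpret mazur_bicontinuous_semigroup scaleK \<tau> P T
  proof unfold_locales
    show "linear_topology scaleK \<tau>" "topology_coarser \<tau> euclidean"
      using saks by (auto simp: saks_space_def locally_convex_topology_def)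
  qed (use P assms(5,6) in auto)
  obtain M where M: "1 \<le> M" "\<And>s. s \<in> {0..1} \<Longrightarrow> norm (T s) \<le> M"
    using T_locally_bounded[of 1] by auto
  note lower = norm_le_bisun_norm[OF assms(1) M]
  have "norm_over scaleK (bisun_norm scaleK \<tau> T)"
    unfolding norm_over_def
  proof (intro conjI allI impI)
    show "x = 0" if "bisun_norm scaleK \<tau> T x = 0" for x using lower[of x] that by simp
  qed (rule seminorm_over_bisun_norm)
  moreover have "norm_over scaleK norm" by (simp add: norm_over_def seminorm_over_norm)
  moreover have "(1 / M) * norm x \<le> bisun_norm scaleK \<tau> T x" for x
    using lower[of x] M(1) by (simp add: field_simps)
  moreover have "bisun_norm scaleK \<tau> T x \<le> 1 * norm x" for x using bisun_norm_le_norm[of x] by simp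
  moreover have "0 < 1 / M" using M(1) by simp
  ultimately show ?thesis unfolding equivalent_norms_def by (meson zero_less_one)
qed

end
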